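(* (a) Let $\varphi\in\Psi$ satisfy $$\limsup_{u\to\infty}\frac{\varphi(u)}{\sqrt u}<\infty .$$ Then for every function $f\in C(G^2)$, $$\lim_{n\to\infty}\left\Vert \frac1n\sum_{l=1}^{n}\left(e^{\varphi\left(\left|S_{l,l}^{\kappa}(f)-f\right|\right)}-1\right)\right\Vert_C=0 .$$ (b) For every function $\varphi\in\Psi$ satisfying $$\limsup_{u\to\infty}\frac{\varphi(u)}{\sqrt u}=\infty$$ there exists a function $F\in C(G^2)$ such that $$\limsup_{m\to\infty}\frac1m\sum_{l=1}^{m}\left(e^{\varphi\left(\left|S_{l,l}^{\kappa}(F;0,0)-F(0,0)\right|\right)}-1\right)=+\infty .$$
   Context: $\Psi$ is the class of functions $\psi:[0,+\infty)\to[0,+\infty)$ that are increasing on $[0,+\infty)$ and satisfy $\lim_{u\to0}\psi(u)=\psi(0)=0$. $\mathbb{N}=\{0,1,2,\dots\}$. $G=\prod_{k\in\mathbb{N}}\mathbb{Z}_2$ is the Walsh group (compact abelian group with product topology, elements $x=(x_0,x_1,\dots)$, $x_k\in\{0,1\}$, coordinatewise addition mod 2, null element $0$), with product measure $\mu$ in which each factor gives mass $1/2$ to each point; $G^2=G\times G$ carries the product measure (also denoted $\mu$). $C(G^2)$ is the space of continuous real-valued functions on $G^2$ and $\|g\|_C=\sup_{(x,y)\in G^2}|g(x,y)|$. Rademacher functions: $r_k(x)=(-1)^{x_k}$. For $n\ge1$ with binary expansion $n=\sum_i n_i2^i$, $n_i\in\{0,1\}$, let $|n|=\max\{j:n_j\ne0\}$.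 Walsh-Kaczmarz functions: $\kappa_0=1$ and, for $n\ge1$, $\kappa_n(x)=r_{|n|}(x)\prod_{k=0}^{|n|-1}(r_{|n|-1-k}(x))^{n_k}$. For $f\in C(G^2)$: $\hat f^{\kappa}(k,i)=\int_{G^2}f(x,y)\kappa_k(x)\kappa_i(y)\,d\mu(x,y)$ and $S_{n,m}^{\kappa}(f;x,y)=\sum_{k=0}^{n-1}\sum_{i=0}^{m-1}\hat f^{\kappa}(k,i)\kappa_k(x)\kappa_i(y)$; $S_{n,m}^\kappa(f)$ denotes the function $(x,y)\mapsto S_{n,m}^\kappa(f;x,y)$. *)

theory Defs
  imports "HOL-Probability.Probability" "HOL-Library.Z2" "HOL-Library.Function_Algebras"
begin

text \<open>The two-element field carries the discrete topology, so that the type-class topology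
  on \<open>nat \<Rightarrow> bit\<close> is the product topology.  Group structure, including the null element
  \<open>0\<close>, comes from the pointwise instances of \<open>Function_Algebras\<close>.\<close>

instantiation bit :: discrete_topology
begin

definition open_bit :: "bit set \<Rightarrow> bool"
  where "open_bit U \<longleftrightarrow> True"

instance
  by standard (simp_all add: open_bit_def)

end

type_synonym walsh = "nat \<Rightarrow> bit"

definition walsh_measure :: "walsh measure"
  where "walsh_measure = (\<Pi>\<^sub>M k\<in>UNIV. uniform_count_measure (UNIV :: bit set))"

text \<open>Functions on the half-line are represented by total functions whose values at negative
  arguments are unconstrained; ``increasing'' is understood in the weak sense.\<close>

definition Psi :: "(real \<Rightarrow> real) set"
  where "Psi = {\<psi>. (\<forall>u\<ge>0. 0 \<le> \<psi> u) \<and> mono_on {0..} \<psi> \<and> \<psi> 0 = 0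
                  \<and> (\<psi> \<longlongrightarrow> 0) (at_right 0)}"

definition sup_norm :: "('a \<Rightarrow> real) \<Rightarrow> real"
  where "sup_norm g = (SUP p. \<bar>g p\<bar>)"

definition rademacher :: "nat \<Rightarrow> walsh \<Rightarrow> real"
  where "rademacher k x = (if x k = 0 then 1 else - 1)"

text \<open>The value at \<open>n = 0\<close> is never used.\<close>

definition top_bit :: "nat \<Rightarrow> nat"
  where "top_bit n = Max {j. bit n j}"

definition kaczmarz :: "nat \<Rightarrow> walsh \<Rightarrow> real"
  where "kaczmarz n x =
    (if n = 0 then 1
     else rademacher (top_bit n) x *
       (\<Prod>k<top_bit n. rademacher (top_bit n - 1 - k) x ^ of_bool (bit n k)))"

definition kaczmarz_coeff :: "(walsh \<times> walsh \<Rightarrow> real) \<Rightarrow> nat \<Rightarrow> nat \<Rightarrow> real"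
  where "kaczmarz_coeff f k i =
    (\<integral>(x, y). f (x, y) * kaczmarz k x * kaczmarz i y \<partial>(walsh_measure \<Otimes>\<^sub>M walsh_measure))"

definition kaczmarz_sum :: "nat \<Rightarrow> nat \<Rightarrow> (walsh \<times> walsh \<Rightarrow> real) \<Rightarrow> walsh \<times> walsh \<Rightarrow> real"
  where "kaczmarz_sum n m f =
    (\<lambda>(x, y). \<Sum>k<n. \<Sum>i<m. kaczmarz_coeff f k i * kaczmarz k x * kaczmarz i y)"

end

theory Submission
  imports Defs
begin

text \<open>For \<open>2 ^ k \<le> l \<le> 2 ^ (k + 1)\<close> the Kaczmarz-Dirichlet kernel is the Walsh-Paley kernel in the
  variables obtained by reversing the first \<open>k\<close> coordinates.  The Paley kernel \<open>D\<^sub>l\<close> is a sum, over the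
  binary digits \<open>i\<close> of \<open>l\<close>, of a character determined by the digits above \<open>i\<close> times \<open>D\<close> of order \<open>2 ^ i\<close>.
  Hence \<open>S\<^sub>l\<^sub>,\<^sub>l f\<close> is a sum over pairs \<open>(i, j)\<close> of terms bounded by \<open>\<parallel>f\<parallel>\<close> which are weighted Fourier
  coefficients at the digits of \<open>l\<close> above \<open>min i j\<close>.  By Bessel's inequality their mean square over
  \<open>l < 2 ^ K\<close> decays like \<open>2 ^ (min i j - K)\<close>.  Since only \<open>t\<^sup>2\<close> pairs have
  \<open>K - 1 - min i j < t\<close>, the means of \<open>\<theta> powr sqrt \<bar>S\<^sub>l\<^sub>,\<^sub>l f\<bar>\<close> are bounded for some \<open>\<theta> > 1\<close> and all
  \<open>f\<close> with \<open>\<parallel>f\<parallel> \<le> 1\<close>; part (a) follows by approximating \<open>f\<close> by functions of finitely many coordinates.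

  For part (b), every dyadic block contains an \<open>l\<close> whose Lebesgue constant is at least \<open>k / 3\<close>, so
  that \<open>S\<^sub>l\<^sub>,\<^sub>l (f; 0, 0)\<close> has norm at least \<open>k\<^sup>2 / 9\<close> as a functional of \<open>f\<close>.  A gliding hump
  \<open>\<Sum>\<^sub>j \<plusminus> 3 ^ (- j) g\<^sub>j\<close> of extremal functions, with signs preventing cancellation, makes a single term
  of the mean exceed \<open>l\<close> by an arbitrarily large factor.\<close>

section \<open>Walsh-Paley characters and Dirichlet kernels\<close>

text \<open>The values \<open>a j\<close> are free reals, so Rademacher values in any order of the
  coordinates, or a shifted sequence, can be inserted without repeating the algebra.\<close>

definition walsh_char :: "(nat \<Rightarrow> real) \<Rightarrow> nat \<Rightarrow> real"
  where "walsh_char a n = (\<Prod>j | bit n j. a j)"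

definition dirichlet :: "(nat \<Rightarrow> real) \<Rightarrow> nat \<Rightarrow> real"
  where "dirichlet a l = (\<Sum>n<l. walsh_char a n)"

lemma bit_less_exp: "bit n j \<Longrightarrow> n < 2 ^ K \<Longrightarrow> j < K" for n :: nat
  by (metis bit_take_bit_iff take_bit_nat_eq_self_iff)

lemma finite_bits [simp]: "finite {j. bit n j}" for n :: nat
  by (rule finite_subset[of _ "{..<n}"]) (auto dest: bit_less_exp[OF _ less_exp])

lemma bit_exp_add: "n < 2 ^ q \<Longrightarrow> bit (2 ^ q + n) j \<longleftrightarrow> j = q \<or> bit n j" for n :: nat
proof -
  assume n: "n < 2 ^ q"
  have "bit (2 ^ q + n) j \<longleftrightarrow> bit (2 ^ q :: nat) j \<or> bit n j"
    by (rule bit_disjunctive_add_iff) (use n in \<open>auto simp: bit_exp_iff dest: bit_less_exp\<close>)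
  then show ?thesis by (auto simp: bit_exp_iff)
qed

lemma walsh_char_0 [simp]: "walsh_char a 0 = 1"
  by (simp add: walsh_char_def)

lemma walsh_char_exp_add:
  assumes "n < 2 ^ q"
  shows "walsh_char a (2 ^ q + n) = a q * walsh_char a n"
proof -
  have "{j. bit (2 ^ q + n) j} = insert q {j. bit n j}"
    using assms by (auto simp: bit_exp_add)
  moreover have "\<not> bit n q"
    using assms bit_less_exp by blast
  ultimately show ?thesis
    by (simp add: walsh_char_def)
qed

lemma walsh_char_mult: "walsh_char (\<lambda>j. a j * b j) n = walsh_char a n * walsh_char b n"
  by (simp add: walsh_char_def prod.distrib)

lemma walsh_char_cong: "(\<And>j. bit n j \<Longrightarrow> a j = b j) \<Longrightarrow> walsh_char a n = walsh_char b n"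
  by (auto simp: walsh_char_def intro!: prod.cong)

text \<open>The factor \<open>a d\<close> occurs at most once in the product. This is the source of
  all orthogonality below: reversing one sign detects one digit of the index.\<close>

lemma walsh_char_flip:
  "walsh_char (\<lambda>j. if j = d then - a j else a j) n = (if bit n d then - 1 else 1) * walsh_char a n"
proof (cases "bit n d")
  case True
  then have "{j. bit n j} = insert d ({j. bit n j} - {d})" by auto
  then have s: "walsh_char f n = f d * prod f ({j. bit n j} - {d})" for f
    unfolding walsh_char_def by (metis True finite_bits mem_Collect_eq prod.remove)
  show ?thesis
    by (simp add: s True)
next
  case False
  then show ?thesis
    by (auto intro!: walsh_char_cong)
qed

lemma abs_walsh_char: "(\<And>j. \<bar>a j\<bar> = 1) \<Longrightarrow> \<bar>walsh_char a n\<bar> = 1"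
  by (simp add: walsh_char_def abs_prod)

text \<open>The indices from 2^q on share the factor \<open>a q\<close>. The case m = 2^q is
  included since only indices n < m occur; it is the doubling step of
  \<open>dirichlet_exp\<close>.\<close>

lemma dirichlet_add:
  assumes "m \<le> 2 ^ q"
  shows "dirichlet a (2 ^ q + m) = dirichlet a (2 ^ q) + a q * dirichlet a m"
  using assms
proof (induction m)
  case (Suc m)
  then show ?case
    using walsh_char_exp_add[of m q a] by (simp add: dirichlet_def distrib_left)
qed (simp add: dirichlet_def)

lemma dirichlet_exp: "dirichlet a (2 ^ q) = (\<Prod>j<q. 1 + a j)"
proof (induction q)
  case (Suc q)
  have "dirichlet a (2 ^ Suc q) = dirichlet a (2 ^ q + 2 ^ q)"
    by (simp add: mult_2)
  also have "\<dots> = (1 + a q) * dirichlet a (2 ^ q)"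
    by (subst dirichlet_add) (auto simp: algebra_simps)
  finally show ?case
    by (simp add: Suc)
qed (simp add: dirichlet_def)

lemma drop_bit_exp_add:
  fixes m :: nat
  assumes "i \<le> q" "m < 2 ^ q"
  shows "drop_bit i (2 ^ q + m) = 2 ^ (q - i) + drop_bit i m" and "drop_bit i m < 2 ^ (q - i)"
proof -
  have e: "(2::nat) ^ q = 2 ^ i * 2 ^ (q - i)"
    using assms by (simp flip: power_add)
  show "drop_bit i (2 ^ q + m) = 2 ^ (q - i) + drop_bit i m"
    by (simp add: drop_bit_eq_div e)
  show "drop_bit i m < 2 ^ (q - i)"
    using assms(2) by (simp add: drop_bit_eq_div e less_mult_imp_div_less mult.commute)
qed

text \<open>Stripping the leading digit of l = 2^K + m leaves the kernel of order m times
  \<open>a K\<close>, and this factor joins the character of every lower term. In the shifted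
  variables it is visible that the i-th term depends, apart from digit i, only on
  \<open>drop_bit (Suc i) l\<close>.\<close>

lemma dirichlet_decomposition:
  assumes "l < 2 ^ K"
  shows "dirichlet a l = (\<Sum>i<K. of_bool (bit l i)
      * (walsh_char (\<lambda>d. a (Suc i + d)) (drop_bit (Suc i) l) * (\<Prod>j<i. 1 + a j)))"
  using assms
proof (induction K arbitrary: l)
  case (Suc K)
  show ?case
  proof (cases "l < 2 ^ K")
    case True
    then have "\<not> bit l K" using bit_less_exp by blast
    then show ?thesis using Suc.IH[OF True] by simp
  next
    case False
    define m where "m = l - 2 ^ K"
    have m: "l = 2 ^ K + m" "m < 2 ^ K"
      using False Suc.prems by (auto simp: m_def)
    have "dirichlet a l = (\<Prod>j<K. 1 + a j) + a K * dirichlet a m"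
      using m by (simp add: dirichlet_add dirichlet_exp)
    also have "a K * dirichlet a m = (\<Sum>i<K. of_bool (bit l i)
      * (walsh_char (\<lambda>d. a (Suc i + d)) (drop_bit (Suc i) l) * (\<Prod>j<i. 1 + a j)))"
    proof -
      have "a K * walsh_char (\<lambda>d. a (Suc i + d)) (drop_bit (Suc i) m)
          = walsh_char (\<lambda>d. a (Suc i + d)) (drop_bit (Suc i) l)" if "i < K" for i
        using that m drop_bit_exp_add[of "Suc i" K m] by (simp add: walsh_char_exp_add del: drop_bit_Suc)
      moreover have "bit l i = bit m i" if "i < K" for i
        using that m by (simp add: bit_exp_add)
      ultimately show ?thesis
        unfolding Suc.IH[OF m(2)] sum_distrib_left by (intro sum.cong refl) (simp flip: mult.assoc)
    qed
    \<comment> \<open>The isolated kernel of order 2^K is the term i = K: no digit of l lies above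
      K, so its character is 1.\<close>
    finally show ?thesis
      using m by (simp add: bit_exp_add drop_bit_eq_div del: drop_bit_Suc)
  qed
qed (simp add: dirichlet_def)

lemma abs_dirichlet_le: "(\<And>j. \<bar>a j\<bar> = 1) \<Longrightarrow> \<bar>dirichlet a l\<bar> \<le> real l"
  unfolding dirichlet_def
  by (rule order_trans[OF sum_abs]) (simp add: abs_walsh_char)

section \<open>Families of independent signs\<close>

context prob_space
begin

text \<open>The bound holds everywhere, not just almost everywhere, so the class is closed under
  sums and products and the integrability of each integrand below follows from its shape.\<close>

definition bounded_measurable :: "('a \<Rightarrow> real) \<Rightarrow> bool"
  where "bounded_measurable g \<longleftrightarrow> g \<in> borel_measurable M \<and> (\<exists>B. \<forall>w. \<bar>g w\<bar> \<le> B)"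

lemma bounded_measurableI: "g \<in> borel_measurable M \<Longrightarrow> (\<And>w. \<bar>g w\<bar> \<le> B) \<Longrightarrow> bounded_measurable g"
  by (auto simp: bounded_measurable_def)

lemma bounded_measurable_integrable: "bounded_measurable g \<Longrightarrow> integrable M g"
  unfolding bounded_measurable_def
  by (metis (no_types, lifting) AE_I2 integrable_const_bound real_norm_def)

lemma bounded_measurable_const: "bounded_measurable (\<lambda>w. c)"
  by (auto simp: bounded_measurable_def)

lemma bounded_measurable_add:
  assumes "bounded_measurable g" "bounded_measurable h"
  shows "bounded_measurable (\<lambda>w. g w + h w)"
proof -
  obtain B C where "\<And>w. \<bar>g w\<bar> \<le> B" "\<And>w. \<bar>h w\<bar> \<le> C"
    using assms by (auto simp: bounded_measurable_def)
  then have "\<bar>g w + h w\<bar> \<le> B + C" for w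
    by (rule order_trans[OF abs_triangle_ineq add_mono])
  with assms show ?thesis
    by (auto simp: bounded_measurable_def)
qed

lemma bounded_measurable_mult:
  assumes "bounded_measurable g" "bounded_measurable h"
  shows "bounded_measurable (\<lambda>w. g w * h w)"
proof -
  obtain B C where "\<And>w. \<bar>g w\<bar> \<le> B" "\<And>w. \<bar>h w\<bar> \<le> C"
    using assms by (auto simp: bounded_measurable_def)
  then have "\<bar>g w * h w\<bar> \<le> B * C" for w
    unfolding abs_mult by (intro mult_mono) (auto intro: order_trans[OF abs_ge_zero])
  with assms show ?thesis
    by (auto simp: bounded_measurable_def)
qed

lemma bounded_measurable_sum:
  "(\<And>i. i \<in> I \<Longrightarrow> bounded_measurable (g i)) \<Longrightarrow> bounded_measurable (\<lambda>w. \<Sum>i\<in>I. g i w)"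
  by (induction I rule: infinite_finite_induct)
     (auto intro: bounded_measurable_add bounded_measurable_const)

lemma bounded_measurable_prod:
  "(\<And>i. i \<in> I \<Longrightarrow> bounded_measurable (g i)) \<Longrightarrow> bounded_measurable (\<lambda>w. \<Prod>i\<in>I. g i w)"
  by (induction I rule: infinite_finite_induct)
     (auto intro: bounded_measurable_mult bounded_measurable_const)

lemma bounded_measurable_abs: "bounded_measurable g \<Longrightarrow> bounded_measurable (\<lambda>w. \<bar>g w\<bar>)"
  by (auto simp: bounded_measurable_def)

lemma bounded_measurable_walsh_char:
  "(\<And>j. bounded_measurable (\<lambda>w. a j w)) \<Longrightarrow> bounded_measurable (\<lambda>w. walsh_char (\<lambda>j. a j w) n)"
  unfolding walsh_char_def by (intro bounded_measurable_prod)

lemma bounded_measurable_dirichlet: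
  "(\<And>j. bounded_measurable (\<lambda>w. a j w)) \<Longrightarrow> bounded_measurable (\<lambda>w. dirichlet (\<lambda>j. a j w) n)"
  unfolding dirichlet_def by (intro bounded_measurable_sum bounded_measurable_walsh_char)

lemmas bounded_measurable_intros =
  bounded_measurable_const bounded_measurable_add bounded_measurable_mult bounded_measurable_sum
  bounded_measurable_prod bounded_measurable_abs bounded_measurable_walsh_char
  bounded_measurable_dirichlet

text \<open>The weighted integral of the square of f minus its expansion is nonnegative. Multiplied
  out, it is the weighted integral of f^2 minus the sum of the squared coefficients, and the former
  is at most 1 because W is a probability density.\<close>

lemma weighted_bessel:
  fixes \<phi> :: "'q \<Rightarrow> 'a \<Rightarrow> real"
  assumes Q: "finite Q"
    and bm: "bounded_measurable f" "bounded_measurable W" "\<And>q. bounded_measurable (\<phi> q)"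
    and W: "\<And>w. 0 \<le> W w" and W1: "(\<integral>w. W w \<partial>M) = 1" and f: "\<And>w. \<bar>f w\<bar> \<le> 1"
    and orth: "\<And>q r. q \<in> Q \<Longrightarrow> r \<in> Q \<Longrightarrow> (\<integral>w. W w * (\<phi> q w * \<phi> r w) \<partial>M) = of_bool (q = r)"
  shows "(\<Sum>q\<in>Q. (\<integral>w. f w * W w * \<phi> q w \<partial>M)\<^sup>2) \<le> 1"
proof -
  define c where "c q = (\<integral>w. f w * W w * \<phi> q w \<partial>M)" for q
  note int = bounded_measurable_integrable
  note bmi = bounded_measurable_intros bm
  have i1: "integrable M (\<lambda>w. W w * (f w * f w))"
    by (intro int bmi)
  have i2: "integrable M (\<lambda>w. \<Sum>q\<in>Q. c q * (f w * W w * \<phi> q w))"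
    by (intro int bmi)
  have i3: "integrable M (\<lambda>w. \<Sum>q\<in>Q. \<Sum>r\<in>Q. c q * c r * (W w * (\<phi> q w * \<phi> r w)))"
    by (intro int bmi)
  have "0 \<le> (\<integral>w. W w * (f w - (\<Sum>q\<in>Q. c q * \<phi> q w))\<^sup>2 \<partial>M)"
    using W by (intro integral_nonneg_AE) auto
  also have "(\<lambda>w. W w * (f w - (\<Sum>q\<in>Q. c q * \<phi> q w))\<^sup>2) = (\<lambda>w. W w * (f w * f w)
      - 2 * (\<Sum>q\<in>Q. c q * (f w * W w * \<phi> q w))
      + (\<Sum>q\<in>Q. \<Sum>r\<in>Q. c q * c r * (W w * (\<phi> q w * \<phi> r w))))" (is "?l = ?r")
  proof
    fix w
    define s where "s = (\<Sum>q\<in>Q. c q * \<phi> q w)"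
    have 1: "(\<Sum>q\<in>Q. c q * (f w * W w * \<phi> q w)) = f w * W w * s"
      by (simp add: s_def sum_distrib_left mult_ac)
    have 2: "(\<Sum>q\<in>Q. \<Sum>r\<in>Q. c q * c r * (W w * (\<phi> q w * \<phi> r w))) = W w * (s * s)"
      unfolding s_def sum_product by (simp add: sum_distrib_left mult_ac)
    show "?l w = ?r w"
      unfolding 1 2 s_def[symmetric] by (simp add: power2_eq_square algebra_simps)
  qed
  also have "(\<integral>w. W w * (f w * f w) - 2 * (\<Sum>q\<in>Q. c q * (f w * W w * \<phi> q w))
      + (\<Sum>q\<in>Q. \<Sum>r\<in>Q. c q * c r * (W w * (\<phi> q w * \<phi> r w))) \<partial>M)
    = (\<integral>w. W w * (f w * f w) \<partial>M) - 2 * (\<integral>w. (\<Sum>q\<in>Q. c q * (f w * W w * \<phi> q w)) \<partial>M)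
      + (\<integral>w. (\<Sum>q\<in>Q. \<Sum>r\<in>Q. c q * c r * (W w * (\<phi> q w * \<phi> r w))) \<partial>M)"
    using i1 i2 i3 by simp
  also have "(\<integral>w. (\<Sum>q\<in>Q. c q * (f w * W w * \<phi> q w)) \<partial>M) = (\<Sum>q\<in>Q. c q * c q)"
    by (subst Bochner_Integration.integral_sum) (auto simp: c_def intro!: int bmi)
  also have "(\<integral>w. (\<Sum>q\<in>Q. \<Sum>r\<in>Q. c q * c r * (W w * (\<phi> q w * \<phi> r w))) \<partial>M)
      = (\<Sum>q\<in>Q. \<Sum>r\<in>Q. c q * c r * of_bool (q = r))"
    by (subst Bochner_Integration.integral_sum, intro int bmi, rule sum.cong[OF refl],
        subst Bochner_Integration.integral_sum, intro int bmi, rule sum.cong[OF refl])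
       (simp add: orth)
  also have "\<dots> = (\<Sum>q\<in>Q. c q * c q)"
    using Q by (intro sum.cong refl) (simp add: of_bool_def if_distrib cong: if_cong)
  also have "(\<integral>w. W w * (f w * f w) \<partial>M) \<le> (\<integral>w. W w \<partial>M)"
  proof (intro integral_mono i1 int bm)
    fix w
    have "f w * f w \<le> 1"
      using f[of w] abs_square_le_1[of "f w"] by (simp add: power2_eq_square)
    then show "W w * (f w * f w) \<le> W w"
      using W[of w] mult_left_le by blast
  qed
  finally show ?thesis
    by (simp add: W1 c_def power2_eq_square)
qed

end

text \<open>The flips encode independence: reversing a single sign preserves the measure.\<close>

locale sign_family = prob_space M for M :: "'a measure" +
  fixes e :: "'i \<Rightarrow> 'a \<Rightarrow> real"
  assumes e_measurable: "e i \<in> borel_measurable M"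
    and abs_e: "\<bar>e i w\<bar> = 1"
    and ex_flip: "\<exists>\<tau>. \<tau> \<in> measurable M M \<and> distr M M \<tau> = M \<and>
                    (\<forall>j w. e j (\<tau> w) = (if j = i then - e j w else e j w))"
begin

definition is_flip :: "'i \<Rightarrow> ('a \<Rightarrow> 'a) \<Rightarrow> bool"
  where "is_flip i \<tau> \<longleftrightarrow> \<tau> \<in> measurable M M \<and> distr M M \<tau> = M \<and>
                    (\<forall>j w. e j (\<tau> w) = (if j = i then - e j w else e j w))"

lemma obtain_flip: obtains \<tau> where "is_flip i \<tau>"
  using ex_flip[of i] by (auto simp: is_flip_def)

lemma e_flip: "is_flip i \<tau> \<Longrightarrow> e j (\<tau> w) = (if j = i then - e j w else e j w)"
  by (simp add: is_flip_def)

lemma integral_flip: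
  fixes g :: "'a \<Rightarrow> real"
  assumes "is_flip i \<tau>" "bounded_measurable g"
  shows "(\<integral>w. g (\<tau> w) \<partial>M) = (\<integral>w. g w \<partial>M)"
  using assms integral_distr[of \<tau> M M g] by (auto simp: is_flip_def bounded_measurable_def)

lemma integral_flip_0:
  fixes g :: "'a \<Rightarrow> real"
  assumes "is_flip i \<tau>" "bounded_measurable g" "\<And>w. g (\<tau> w) = - g w"
  shows "(\<integral>w. g w \<partial>M) = 0"
  using integral_flip[OF assms(1,2)] by (simp add: assms(3))

lemma bounded_measurable_e: "bounded_measurable (e i)"
  using abs_e[of i] by (intro bounded_measurableI e_measurable eq_refl)

lemma e_ge: "0 \<le> 1 + e i w"
  using abs_e[of i w] by linarith

text \<open>Multiplying out one factor leaves \<open>e i\<close> times a product that does not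
  contain it; reversing sign i negates this term, so its integral vanishes.\<close>

lemma integral_prod_one_plus:
  assumes "finite I"
  shows "(\<integral>w. (\<Prod>i\<in>I. 1 + e i w) \<partial>M) = 1"
  using assms
proof (induction I)
  case (insert i I)
  note bmi = bounded_measurable_intros bounded_measurable_e
  obtain \<tau> where \<tau>: "is_flip i \<tau>" by (rule obtain_flip)
  have eq: "(\<Prod>i\<in>I. 1 + e i (\<tau> w)) = (\<Prod>i\<in>I. 1 + e i w)" for w
    using insert by (intro prod.cong refl) (auto simp: e_flip[OF \<tau>])
  have "(\<integral>w. e i w * (\<Prod>i\<in>I. 1 + e i w) \<partial>M) = 0"
    by (rule integral_flip_0[OF \<tau>]) (auto intro!: bmi simp only: eq, simp add: e_flip[OF \<tau>])
  moreover have "(\<integral>w. (\<Prod>i\<in>I. 1 + e i w) + e i w * (\<Prod>i\<in>I. 1 + e i w) \<partial>M)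
     = (\<integral>w. (\<Prod>i\<in>I. 1 + e i w) \<partial>M) + (\<integral>w. e i w * (\<Prod>i\<in>I. 1 + e i w) \<partial>M)"
    by (intro Bochner_Integration.integral_add bounded_measurable_integrable bmi)
  ultimately show ?case
    using insert by (simp add: algebra_simps)
qed (simp add: prob_space)

text \<open>Distinct indices q and r differ in some digit d. Reversing \<open>e (\<alpha> d)\<close>
  fixes the weight and the \<beta>-characters and negates exactly one of the two
  \<alpha>-characters, which is the orthogonality needed for Bessel's inequality. Hence
  \<open>h\<close> can be any function of q.\<close>

lemma sum_square_coefficients_le:
  assumes I: "finite I" and Q: "finite Q" and f: "bounded_measurable f" "\<And>w. \<bar>f w\<bar> \<le> 1"
    and \<alpha>: "inj \<alpha>" "range \<alpha> \<inter> I = {}" "range \<alpha> \<inter> range \<beta> = {}"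
  shows "(\<Sum>q\<in>Q. (\<integral>w. f w * (\<Prod>i\<in>I. 1 + e i w) *
      (walsh_char (\<lambda>j. e (\<alpha> j) w) q * walsh_char (\<lambda>j. e (\<beta> j) w) (h q)) \<partial>M)\<^sup>2) \<le> 1"
proof (rule weighted_bessel[OF Q f(1) _ _ _ integral_prod_one_plus[OF I] f(2)])
  note bmi = bounded_measurable_intros bounded_measurable_e
  show "bounded_measurable (\<lambda>w. \<Prod>i\<in>I. 1 + e i w)"
    by (intro bmi)
  define ch where "ch q w = walsh_char (\<lambda>j. e (\<alpha> j) w) q * walsh_char (\<lambda>j. e (\<beta> j) w) (h q)" for q w
  show bmch: "bounded_measurable (ch q)" for q
    unfolding ch_def[abs_def] by (intro bmi)
  have absch: "\<bar>ch q w\<bar> = 1" for q w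
    by (simp add: ch_def abs_mult abs_walsh_char abs_e)
  fix q r
  show "(\<integral>w. (\<Prod>i\<in>I. 1 + e i w) * (ch q w * ch r w) \<partial>M) = of_bool (q = r)"
  proof (cases "q = r")
    case True
    have "ch q w * ch q w = 1" for w
      using absch[of q w] by (metis abs_mult_self_eq mult_1)
    then show ?thesis
      using True integral_prod_one_plus[OF I] by simp
  next
    case False
    then obtain d where d: "bit q d \<noteq> bit r d"
      by (metis bit_eq_iff)
    obtain \<tau> where \<tau>: "is_flip (\<alpha> d) \<tau>" by (rule obtain_flip)
    have 1: "(\<Prod>i\<in>I. 1 + e i (\<tau> w)) = (\<Prod>i\<in>I. 1 + e i w)" for w
      using \<alpha> by (intro prod.cong refl) (auto simp: e_flip[OF \<tau>])
    have 2: "ch q (\<tau> w) = (if bit q d then - 1 else 1) * ch q w" for q w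
    proof -
      have "(\<lambda>j. e (\<alpha> j) (\<tau> w)) = (\<lambda>j. if j = d then - e (\<alpha> j) w else e (\<alpha> j) w)"
        using \<alpha> by (auto simp: e_flip[OF \<tau>] inj_eq)
      moreover have "(\<lambda>j. e (\<beta> j) (\<tau> w)) = (\<lambda>j. e (\<beta> j) w)"
        using \<alpha>(3) by (auto simp: e_flip[OF \<tau>] fun_eq_iff)
      ultimately show ?thesis
        unfolding ch_def by (simp only: walsh_char_flip mult.assoc)
    qed
    show ?thesis
      using False d
      by (simp, intro integral_flip_0[OF \<tau>] bmi bmch) (auto simp: 1 2)
  qed
qed (auto intro: prod_nonneg e_ge)

end

section \<open>Exponential estimate for a dyadic block\<close>

text \<open>Each q is the value of \<open>drop_bit s\<close> on a run of 2^s consecutive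
  arguments.\<close>

lemma sum_drop_bit:
  fixes g :: "nat \<Rightarrow> real"
  assumes "s \<le> K"
  shows "(\<Sum>l<2 ^ K. g (drop_bit s l)) = 2 ^ s * (\<Sum>q<2 ^ (K - s). g q)"
proof -
  have K: "(2::nat) ^ K = 2 ^ (K - s) * 2 ^ s"
    using assms by (simp flip: power_add)
  have "(\<Sum>l<2 ^ K. g (drop_bit s l)) = (\<Sum>q<2 ^ (K - s). \<Sum>l = q * 2 ^ s..<q * 2 ^ s + 2 ^ s. g (drop_bit s l))"
    unfolding K by (rule sum.nat_group[symmetric])
  also have "\<dots> = (\<Sum>q<2 ^ (K - s). \<Sum>l = q * 2 ^ s..<q * 2 ^ s + 2 ^ s. g q)"
  proof (intro sum.cong refl arg_cong[where f = g])
    fix q l :: nat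
    assume "l \<in> {q * 2 ^ s..<q * 2 ^ s + 2 ^ s}"
    then show "drop_bit s l = q"
      by (auto simp: drop_bit_eq_div div_nat_eqI mult.commute)
  qed
  finally show ?thesis
    by (simp add: sum_distrib_left)
qed

text \<open>Let Y be the weighted double sum and 1 + Y \<le> \<theta>^t. At most t^2 pairs have both
  indices at least K - t, and there T \<le> 1; on the other pairs the weight is at least \<theta>^t,
  so they contribute at most Y / \<theta>^t \<le> 1. Thus X \<le> t^2 + 1, and the root turns t^2
  into an exponent linear in t.\<close>

lemma powr_sqrt_sum_le:
  fixes T :: "nat \<Rightarrow> nat \<Rightarrow> real"
  assumes \<theta>: "1 < \<theta>"
    and T: "\<And>i j. i < K \<Longrightarrow> j < K \<Longrightarrow> 0 \<le> T i j \<and> T i j \<le> 1"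
    and X: "X \<le> (\<Sum>i<K. \<Sum>j<K. T i j)"
  shows "\<theta> powr sqrt X \<le> \<theta>\<^sup>2 * (1 + (\<Sum>i<K. \<Sum>j<K. \<theta> ^ (K - 1 - min i j) * T i j))"
proof -
  define Y where "Y = (\<Sum>i<K. \<Sum>j<K. \<theta> ^ (K - 1 - min i j) * T i j)"
  have Y0: "0 \<le> Y"
    unfolding Y_def using T \<theta> by (intro sum_nonneg mult_nonneg_nonneg) auto
  \<comment> \<open>The least t with 1 + Y \<le> \<theta>^t. Rounding up costs one factor \<theta>,
    and replacing the root of t^2 + 1 by t + 1 costs the other one.\<close>
  define t where "t = nat \<lceil>log \<theta> (1 + Y)\<rceil>"
  have lg: "0 \<le> log \<theta> (1 + Y)"
    using \<theta> Y0 by (simp add: zero_le_log_cancel_iff)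
  then have t1: "log \<theta> (1 + Y) \<le> real t" and t2: "real t \<le> 1 + log \<theta> (1 + Y)"
    unfolding t_def by linarith+
  have "1 + Y \<le> \<theta> powr real t"
    using t1 \<theta> Y0 by (simp add: log_le_iff)
  then have tY: "1 + Y \<le> \<theta> ^ t"
    using \<theta> by (simp add: powr_realpow)
  have "T i j \<le> of_bool (i \<in> {K - t..<K}) * of_bool (j \<in> {K - t..<K})
          + \<theta> ^ (K - 1 - min i j) * T i j / \<theta> ^ t" if "i < K" "j < K" for i j
  proof (cases "K - t \<le> min i j")
    case True
    moreover have "0 \<le> \<theta> ^ (K - 1 - min i j) * T i j / \<theta> ^ t"
      using T[OF that] \<theta> by simp
    ultimately show ?thesis
      using that T[OF that] by (auto simp del: diff_Suc_1 diff_diff_left)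
  next
    case False
    then have "t \<le> K - 1 - min i j"
      using that by auto
    then have "\<theta> ^ t \<le> \<theta> ^ (K - 1 - min i j)"
      using \<theta> by (intro power_increasing) auto
    then have "T i j * \<theta> ^ t \<le> \<theta> ^ (K - 1 - min i j) * T i j"
      using T[OF that] by (subst mult.commute) (simp add: mult_right_mono)
    then have "T i j \<le> \<theta> ^ (K - 1 - min i j) * T i j / \<theta> ^ t"
      using \<theta> by (simp add: pos_le_divide_eq)
    then show ?thesis
      by (auto simp: of_bool_def)
  qed
  then have "(\<Sum>i<K. \<Sum>j<K. T i j) \<le> (\<Sum>i<K. \<Sum>j<K. of_bool (i \<in> {K - t..<K}) * of_bool (j \<in> {K - t..<K})
          + \<theta> ^ (K - 1 - min i j) * T i j / \<theta> ^ t)"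
    by (intro sum_mono) auto
  also have "\<dots> = (\<Sum>i<K. of_bool (i \<in> {K - t..<K})) * (\<Sum>i<K. of_bool (i \<in> {K - t..<K})) + Y / \<theta> ^ t"
    unfolding sum_product by (simp only: sum.distrib Y_def sum_divide_distrib)
  also have "(\<Sum>i<K. of_bool (i \<in> {K - t..<K}) :: real) = real (card ({..<K} \<inter> {K - t..<K}))"
    by (auto simp: of_bool_def sum.If_cases intro!: arg_cong[where f = card])
  also have "{..<K} \<inter> {K - t..<K} = {K - t..<K}"
    by auto
  also have "real (card {K - t..<K}) * real (card {K - t..<K}) + Y / \<theta> ^ t \<le> real t * real t + 1"
    using tY \<theta> Y0 by (intro add_mono mult_mono) (auto simp: divide_le_eq_1)
  also have "\<dots> \<le> (real t + 1)\<^sup>2"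
    by (simp add: power2_eq_square algebra_simps)
  finally have "sqrt X \<le> real t + 1"
    using X by (metis (no_types, lifting) add_increasing2 of_nat_0_le_iff order_trans real_le_lsqrt real_sqrt_le_iff real_sqrt_unique zero_le_one)
  then have "\<theta> powr sqrt X \<le> \<theta> powr (2 + log \<theta> (1 + Y))"
    using t2 \<theta> by (intro powr_mono) auto
  also have "\<dots> = \<theta>\<^sup>2 * (1 + Y)"
    using \<theta> Y0 by (simp add: powr_add)
  finally show ?thesis
    by (simp add: Y_def)
qed

context sign_family
begin

text \<open>For injective \<alpha>, \<beta> with disjoint ranges the weight is the product of the
  Dirichlet kernels of orders 2^i and 2^j. It is kept as one product over a set of signs, the form
  covered by \<open>integral_prod_one_plus\<close> and
  \<open>sum_square_coefficients_le\<close>.\<close>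

definition kernel_coeff where
  "kernel_coeff f \<alpha> \<beta> i j l = (\<integral>w. f w * (\<Prod>k\<in>\<alpha> ` {..<i} \<union> \<beta> ` {..<j}. 1 + e k w) *
      (walsh_char (\<lambda>d. e (\<alpha> (Suc i + d)) w) (drop_bit (Suc i) l)
       * walsh_char (\<lambda>d. e (\<beta> (Suc j + d)) w) (drop_bit (Suc j) l)) \<partial>M)"

lemma kernel_coeff_swap: "kernel_coeff f \<alpha> \<beta> i j l = kernel_coeff f \<beta> \<alpha> j i l"
  unfolding kernel_coeff_def by (simp only: mult.commute Un_commute)

text \<open>The weight is a probability density and the characters have modulus 1.\<close>

lemma abs_kernel_coeff_le_1:
  assumes f: "bounded_measurable f" "\<And>w. \<bar>f w\<bar> \<le> 1"
  shows "\<bar>kernel_coeff f \<alpha> \<beta> i j l\<bar> \<le> 1"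
proof -
  note bmi = bounded_measurable_intros bounded_measurable_e f(1)
  define W where "W w = (\<Prod>k\<in>\<alpha> ` {..<i} \<union> \<beta> ` {..<j}. 1 + e k w)" for w
  have W: "0 \<le> W w" for w
    unfolding W_def by (intro prod_nonneg ballI e_ge)
  have W1: "(\<integral>w. W w \<partial>M) = 1"
    unfolding W_def by (intro integral_prod_one_plus) auto
  have bmW: "bounded_measurable W"
    unfolding W_def by (intro bmi)
  define ch where "ch w = walsh_char (\<lambda>d. e (\<alpha> (Suc i + d)) w) (drop_bit (Suc i) l)
       * walsh_char (\<lambda>d. e (\<beta> (Suc j + d)) w) (drop_bit (Suc j) l)" for w
  have ch: "\<bar>ch w\<bar> = 1" for w
    by (simp add: ch_def abs_mult abs_walsh_char abs_e)
  have bmch: "bounded_measurable ch"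
    unfolding ch_def by (intro bmi)
  have "\<bar>\<integral>w. f w * W w * ch w \<partial>M\<bar> \<le> (\<integral>w. \<bar>f w * W w * ch w\<bar> \<partial>M)"
    by (rule integral_abs_bound)
  also have "\<dots> \<le> (\<integral>w. W w \<partial>M)"
  proof (intro integral_mono bounded_measurable_integrable bmi bmW bmch)
    show "\<bar>f w * W w * ch w\<bar> \<le> W w" for w
      using mult_right_mono[OF f(2)[of w] W[of w]] W[of w] by (simp add: abs_mult ch)
  qed
  also note W1
  finally show ?thesis
    unfolding kernel_coeff_def W_def ch_def .
qed

lemma integral_dirichlet_decomposition:
  assumes f: "bounded_measurable f"
    and inj: "inj \<alpha>" "inj \<beta>" "range \<alpha> \<inter> range \<beta> = {}" and l: "l < 2 ^ K"
  shows "(\<integral>w. f w * dirichlet (\<lambda>j. e (\<alpha> j) w) l * dirichlet (\<lambda>j. e (\<beta> j) w) l \<partial>M)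
     = (\<Sum>i<K. \<Sum>j<K. of_bool (bit l i \<and> bit l j) * kernel_coeff f \<alpha> \<beta> i j l)"
proof -
  note bmi = bounded_measurable_intros bounded_measurable_e f
  have ne: "\<alpha> x \<noteq> \<beta> y" for x y
    using inj(3) by (metis disjoint_iff rangeI)
  have W: "(\<Prod>k\<in>\<alpha> ` {..<i} \<union> \<beta> ` {..<j}. 1 + e k w)
      = (\<Prod>k<i. 1 + e (\<alpha> k) w) * (\<Prod>k<j. 1 + e (\<beta> k) w)" for i j w
    using inj by (subst prod.union_disjoint) (auto simp: prod.reindex inj_on_def ne)
  have "f w * dirichlet (\<lambda>j. e (\<alpha> j) w) l * dirichlet (\<lambda>j. e (\<beta> j) w) l
    = (\<Sum>i<K. \<Sum>j<K. of_bool (bit l i \<and> bit l j) *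
        (f w * (\<Prod>k\<in>\<alpha> ` {..<i} \<union> \<beta> ` {..<j}. 1 + e k w) *
      (walsh_char (\<lambda>d. e (\<alpha> (Suc i + d)) w) (drop_bit (Suc i) l)
       * walsh_char (\<lambda>d. e (\<beta> (Suc j + d)) w) (drop_bit (Suc j) l))))" for w
    unfolding dirichlet_decomposition[OF l] W mult.assoc
    unfolding sum_product
    unfolding sum_distrib_left
    by (intro sum.cong refl) (simp add: of_bool_conj mult_ac del: drop_bit_Suc)
  then have "(\<integral>w. f w * dirichlet (\<lambda>j. e (\<alpha> j) w) l * dirichlet (\<lambda>j. e (\<beta> j) w) l \<partial>M)
    = (\<integral>w. (\<Sum>i<K. \<Sum>j<K. of_bool (bit l i \<and> bit l j) *
        (f w * (\<Prod>k\<in>\<alpha> ` {..<i} \<union> \<beta> ` {..<j}. 1 + e k w) *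
      (walsh_char (\<lambda>d. e (\<alpha> (Suc i + d)) w) (drop_bit (Suc i) l)
       * walsh_char (\<lambda>d. e (\<beta> (Suc j + d)) w) (drop_bit (Suc j) l)))) \<partial>M)"
    by (simp only:)
  also have "\<dots> = (\<Sum>i<K. \<Sum>j<K. of_bool (bit l i \<and> bit l j) * kernel_coeff f \<alpha> \<beta> i j l)"
    unfolding kernel_coeff_def
    by (subst Bochner_Integration.integral_sum, intro bounded_measurable_integrable bmi,
        rule sum.cong[OF refl],
        subst Bochner_Integration.integral_sum, intro bounded_measurable_integrable bmi,
        rule sum.cong[OF refl], rule Bochner_Integration.integral_mult_right_zero)
  finally show ?thesis .
qed

text \<open>For i \<le> j the digits above j are among those above i, so the coefficient is a
  function g of q = \<open>drop_bit (Suc i) l\<close>. Bessel's inequality bounds the sum of g^2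
  over q by 1, and each q arises from 2^(i+1) values of l.\<close>

lemma sum_square_kernel_coeff_aux:
  assumes f: "bounded_measurable f" "\<And>w. \<bar>f w\<bar> \<le> 1"
    and inj: "inj \<alpha>" "range \<alpha> \<inter> range \<beta> = {}" and ij: "i \<le> j" "i < K"
  shows "(\<Sum>l<2 ^ K. (kernel_coeff f \<alpha> \<beta> i j l)\<^sup>2) \<le> 2 ^ Suc i"
proof -
  have ne: "\<alpha> x \<noteq> \<beta> y" "\<beta> y \<noteq> \<alpha> x" for x y
    using inj(2) by (metis disjoint_iff rangeI)+
  define g where "g q = (\<integral>w. f w * (\<Prod>k\<in>\<alpha> ` {..<i} \<union> \<beta> ` {..<j}. 1 + e k w) *
      (walsh_char (\<lambda>d. e (\<alpha> (Suc i + d)) w) q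
       * walsh_char (\<lambda>d. e (\<beta> (Suc j + d)) w) (drop_bit (j - i) q)) \<partial>M)" for q
  have "drop_bit (Suc j) l = drop_bit (j - i) (drop_bit (Suc i) l)" for l :: nat
    using ij by (simp add: drop_bit_drop_bit del: drop_bit_Suc)
  then have "kernel_coeff f \<alpha> \<beta> i j l = g (drop_bit (Suc i) l)" for l
    unfolding kernel_coeff_def g_def by (simp only:)
  then have "(\<Sum>l<2 ^ K. (kernel_coeff f \<alpha> \<beta> i j l)\<^sup>2) = 2 ^ Suc i * (\<Sum>q<2 ^ (K - Suc i). (g q)\<^sup>2)"
    using sum_drop_bit[of "Suc i" K "\<lambda>q. (g q)\<^sup>2"] ij by (simp del: drop_bit_Suc)
  also have "(\<Sum>q<2 ^ (K - Suc i). (g q)\<^sup>2) \<le> 1"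
    unfolding g_def using inj
    by (intro sum_square_coefficients_le f) (auto simp: inj_eq[OF inj(1)] ne intro!: injI)
  finally show ?thesis
    by simp
qed

lemma sum_square_kernel_coeff:
  assumes f: "bounded_measurable f" "\<And>w. \<bar>f w\<bar> \<le> 1"
    and inj: "inj \<alpha>" "inj \<beta>" "range \<alpha> \<inter> range \<beta> = {}" and ij: "i < K" "j < K"
  shows "(\<Sum>l<2 ^ K. (kernel_coeff f \<alpha> \<beta> i j l)\<^sup>2) \<le> 2 ^ Suc (min i j)"
proof (cases "i \<le> j")
  case True
  then show ?thesis
    using sum_square_kernel_coeff_aux[OF f inj(1,3) True ij(1)] by (simp add: min_def)
next
  case False
  then show ?thesis
    using sum_square_kernel_coeff_aux[OF f inj(2), of \<alpha> j i K] inj(3) ij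
    by (simp add: min_def kernel_coeff_swap[of f \<alpha>] Int_commute)
qed

end

text \<open>The eighth root of \<open>1/2\<close> lets every power occurring below be a natural one.\<close>

definition half_root :: real
  where "half_root = root 8 (1 / 2)"

lemma half_root: "0 < half_root" "half_root < 1" "half_root ^ 8 = 1 / 2"
  by (auto simp: half_root_def)

text \<open>This is 2^(1/4). The mean modulus of a coefficient decays like 2^(-a/2) with a = K - 1 -
  min i j; a growth of 2^(a/4) leaves 2^(-a/4) for the summation over i and j.\<close>

definition growth_base :: real
  where "growth_base = 1 / half_root\<^sup>2"

text \<open>The square of \<open>growth_base\<close> comes from \<open>powr_sqrt_sum_le\<close>, the
  fraction from a squared geometric series in \<open>half_root\<close>.\<close>

definition growth_const :: real
  where "growth_const = growth_base\<^sup>2 * (1 + 1 / (1 - half_root)\<^sup>2)"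

lemma growth_base_gt_1: "1 < growth_base"
  using half_root by (simp add: growth_base_def power_less_one_iff)

lemma growth_const_pos: "0 < growth_const"
  using growth_base_gt_1 half_root unfolding growth_const_def
  by (intro mult_pos_pos add_pos_nonneg) auto

context sign_family
begin

lemma sum_abs_kernel_coeff:
  assumes f: "bounded_measurable f" "\<And>w. \<bar>f w\<bar> \<le> 1"
    and inj: "inj \<alpha>" "inj \<beta>" "range \<alpha> \<inter> range \<beta> = {}" and ij: "i < K" "j < K"
  shows "growth_base ^ (K - 1 - min i j) * (\<Sum>l<2 ^ K. \<bar>kernel_coeff f \<alpha> \<beta> i j l\<bar>)
           \<le> 2 ^ K * (half_root ^ (K - 1 - i) * half_root ^ (K - 1 - j))"
proof -
  define a where "a = K - 1 - min i j"
  \<comment> \<open>\<gamma> = 2^(-a/2) bounds the root mean square of the coefficients over l <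
    2^K, which makes it the optimal parameter in the following inequality.\<close>
  define \<gamma> where "\<gamma> = half_root ^ (4 * a)"
  have \<gamma>: "0 < \<gamma>"
    using half_root by (simp add: \<gamma>_def)
  have \<gamma>2: "\<gamma>\<^sup>2 = 1 / 2 ^ a"
  proof -
    have "\<gamma>\<^sup>2 = (half_root ^ 8) ^ a"
      by (simp add: \<gamma>_def mult.commute flip: power_mult)
    then show ?thesis
      by (simp add: half_root power_one_over)
  qed
  \<comment> \<open>AM-GM replaces the Cauchy-Schwarz inequality.\<close>
  have amgm: "\<bar>x\<bar> \<le> (\<gamma> + x\<^sup>2 / \<gamma>) / 2" for x :: real
  proof -
    have "0 \<le> (\<gamma> - \<bar>x\<bar>)\<^sup>2 / \<gamma>"
      using \<gamma> by simp
    then show ?thesis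
      using \<gamma> by (simp add: field_simps power2_eq_square)
  qed
  have "(\<Sum>l<2 ^ K. \<bar>kernel_coeff f \<alpha> \<beta> i j l\<bar>) \<le> (\<Sum>l<2 ^ K. (\<gamma> + (kernel_coeff f \<alpha> \<beta> i j l)\<^sup>2 / \<gamma>) / 2)"
    by (intro sum_mono amgm)
  also have "\<dots> = (2 ^ K * \<gamma> + (\<Sum>l<2 ^ K. (kernel_coeff f \<alpha> \<beta> i j l)\<^sup>2) / \<gamma>) / 2"
    by (simp add: sum.distrib flip: sum_divide_distrib)
  also have "\<dots> \<le> (2 ^ K * \<gamma> + 2 ^ Suc (min i j) / \<gamma>) / 2"
    using \<gamma> sum_square_kernel_coeff[OF f inj ij] by (simp add: divide_right_mono)
  also have "(2::real) ^ Suc (min i j) = 2 ^ K * \<gamma>\<^sup>2"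
  proof -
    have "K = Suc (min i j) + a"
      using ij by (auto simp: a_def)
    then have "(2::real) ^ K = 2 ^ Suc (min i j) * 2 ^ a"
      by (metis power_add)
    then show ?thesis
      by (simp add: \<gamma>2)
  qed
  also have "(2 ^ K * \<gamma> + 2 ^ K * \<gamma>\<^sup>2 / \<gamma>) / 2 = 2 ^ K * \<gamma>"
    using \<gamma> by (simp add: power2_eq_square)
  finally have "growth_base ^ a * (\<Sum>l<2 ^ K. \<bar>kernel_coeff f \<alpha> \<beta> i j l\<bar>) \<le> growth_base ^ a * (2 ^ K * \<gamma>)"
    using growth_base_gt_1 by (intro mult_left_mono) auto
  also have "growth_base ^ a * \<gamma> = half_root ^ (2 * a)"
  proof -
    have "\<gamma> = half_root ^ (2 * a) * half_root ^ (2 * a)"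
      by (simp add: \<gamma>_def flip: power_add)
    then show ?thesis
      using half_root by (simp add: growth_base_def power_one_over flip: power_mult)
  qed
  then have "growth_base ^ a * (2 ^ K * \<gamma>) = 2 ^ K * half_root ^ (2 * a)"
    by (simp add: mult.left_commute)
  \<comment> \<open>Both K - 1 - i and K - 1 - j are at most a. The decay now factorises, so the
    later sum over i and j becomes a square.\<close>
  also have "half_root ^ (2 * a) \<le> half_root ^ ((K - 1 - i) + (K - 1 - j))"
    using half_root by (intro power_decreasing) (auto simp: a_def)
  finally show ?thesis
    by (simp add: a_def power_add)
qed

text \<open>The bound of \<open>powr_sqrt_sum_le\<close> is linear in the moduli of the
  coefficients, so summation over l can be carried out inside the double sum, where only the mean
  moduli enter.\<close>

lemma sum_growth_le:
  assumes f: "bounded_measurable f" "\<And>w. \<bar>f w\<bar> \<le> 1"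
    and inj: "inj \<alpha>" "inj \<beta>" "range \<alpha> \<inter> range \<beta> = {}"
  shows "(\<Sum>l<2 ^ K. growth_base powr
      sqrt \<bar>\<integral>w. f w * dirichlet (\<lambda>j. e (\<alpha> j) w) l * dirichlet (\<lambda>j. e (\<beta> j) w) l \<partial>M\<bar>)
    \<le> growth_const * 2 ^ K"
proof -
  define T where "T l i j = \<bar>kernel_coeff f \<alpha> \<beta> i j l\<bar>" for l i j
  have T: "0 \<le> T l i j \<and> T l i j \<le> 1" for l i j
    using abs_kernel_coeff_le_1[OF f] by (auto simp: T_def)
  have "growth_base powr
      sqrt \<bar>\<integral>w. f w * dirichlet (\<lambda>j. e (\<alpha> j) w) l * dirichlet (\<lambda>j. e (\<beta> j) w) l \<partial>M\<bar>
    \<le> growth_base\<^sup>2 * (1 + (\<Sum>i<K. \<Sum>j<K. growth_base ^ (K - 1 - min i j) * T l i j))"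
    if "l < 2 ^ K" for l
    unfolding integral_dirichlet_decomposition[OF f(1) inj that]
    by (intro powr_sqrt_sum_le growth_base_gt_1 T order_trans[OF sum_abs] sum_mono)
       (auto simp: T_def abs_mult)
  then have "(\<Sum>l<2 ^ K. growth_base powr
      sqrt \<bar>\<integral>w. f w * dirichlet (\<lambda>j. e (\<alpha> j) w) l * dirichlet (\<lambda>j. e (\<beta> j) w) l \<partial>M\<bar>)
    \<le> (\<Sum>l<2 ^ K. growth_base\<^sup>2 * (1 + (\<Sum>i<K. \<Sum>j<K. growth_base ^ (K - 1 - min i j) * T l i j)))"
    by (intro sum_mono) auto
  also have "\<dots> = growth_base\<^sup>2 * (2 ^ K + (\<Sum>l<2 ^ K. \<Sum>i<K. \<Sum>j<K. growth_base ^ (K - 1 - min i j) * T l i j))"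
    by (simp add: sum.distrib flip: sum_distrib_left)
  also have "(\<Sum>l<2 ^ K. \<Sum>i<K. \<Sum>j<K. growth_base ^ (K - 1 - min i j) * T l i j)
     = (\<Sum>i<K. \<Sum>j<K. growth_base ^ (K - 1 - min i j) * (\<Sum>l<2 ^ K. T l i j))"
    unfolding sum_distrib_left by (subst sum.swap, rule sum.cong[OF refl], rule sum.swap)
  also have "\<dots> \<le> (\<Sum>i<K. \<Sum>j<K. 2 ^ K * (half_root ^ (K - 1 - i) * half_root ^ (K - 1 - j)))"
    unfolding T_def by (intro sum_mono sum_abs_kernel_coeff f inj) auto
  also have "\<dots> = 2 ^ K * (\<Sum>i<K. half_root ^ (K - 1 - i))\<^sup>2"
    by (simp add: power2_eq_square sum_product flip: sum_distrib_left)
  also have "(\<Sum>i<K. half_root ^ (K - 1 - i)) = (\<Sum>i<K. half_root ^ i)"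
    using sum.nat_diff_reindex[of "\<lambda>i. half_root ^ i" K] by simp
  also have "(\<Sum>i<K. half_root ^ i)\<^sup>2 \<le> (1 / (1 - half_root))\<^sup>2"
    using half_root by (intro power_mono sum_nonneg) (auto simp: sum_gp_strict divide_right_mono)
  also have "growth_base\<^sup>2 * (2 ^ K + 2 ^ K * (1 / (1 - half_root))\<^sup>2) = growth_const * 2 ^ K"
    by (simp add: growth_const_def power_one_over algebra_simps)
  finally show ?thesis
    by (simp add: mult_left_mono)
qed

end

section \<open>The Walsh group and the Kaczmarz kernel\<close>

lemma UNIV_bit: "(UNIV :: bit set) = {0, 1}"
  by (auto intro: bit.exhaust)

lemma finite_UNIV_bit [simp]: "finite (UNIV :: bit set)"
  by (simp add: UNIV_bit)

text \<open>Second countability identifies the product sigma-algebra with the Borel sets, so that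
  continuous functions on the group and on its square are measurable.\<close>

instance bit :: second_countable_topology
proof
  have "countable (UNIV :: bit set set)"
    by (simp add: Finite_Set.finite_set countable_finite)
  moreover have "open = generate_topology (UNIV :: bit set set)"
    by (auto simp: fun_eq_iff open_bit_def intro: generate_topology.Basis)
  ultimately show "\<exists>B::bit set set. countable B \<and> open = generate_topology B"
    by blast
qed

lemma prob_space_bit: "prob_space (uniform_count_measure (UNIV :: bit set))"
  by (intro prob_space_uniform_count_measure) auto

interpretation walsh_product: product_prob_space "\<lambda>_::nat. uniform_count_measure (UNIV :: bit set)" UNIV
  by (intro product_prob_spaceI prob_space_bit)

lemma prob_space_walsh: "prob_space walsh_measure"
  unfolding walsh_measure_def by (rule walsh_product.P.prob_space_axioms)

interpretation walsh: prob_space walsh_measure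
  by (rule prob_space_walsh)

interpretation walsh2: pair_prob_space walsh_measure walsh_measure ..

lemma sets_walsh: "sets walsh_measure = sets borel"
proof -
  have "sets (uniform_count_measure (UNIV :: bit set)) = sets borel"
    by (auto simp: sets_uniform_count_measure open_bit_def intro!: borel_open)
  then have "sets walsh_measure = sets (\<Pi>\<^sub>M k\<in>(UNIV::nat set). (borel :: bit measure))"
    unfolding walsh_measure_def by (intro sets_PiM_cong) auto
  then show ?thesis
    by (simp add: sets_PiM_equal_borel)
qed

lemma space_walsh [simp]: "space walsh_measure = UNIV"
  using sets_eq_imp_space_eq[OF sets_walsh] by simp

lemma sets_walsh2: "sets (walsh_measure \<Otimes>\<^sub>M walsh_measure) = sets borel"
  using sets_pair_measure_cong[OF sets_walsh sets_walsh] by (simp only: borel_prod)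

lemma continuous_rademacher: "continuous_on UNIV (rademacher k)"
proof -
  have "continuous_on UNIV (\<lambda>b::bit. if b = 0 then 1 else - 1 :: real)"
    by (simp add: continuous_on_discrete)
  then have "continuous_on UNIV (\<lambda>x::walsh. if x k = 0 then 1 else - 1 :: real)"
    by (rule continuous_on_compose2) auto
  then show ?thesis
    by (simp add: rademacher_def[abs_def])
qed

lemma rademacher_add: "rademacher k (x + s) = rademacher k x * rademacher k s"
  by (cases "x k"; cases "s k") (auto simp: rademacher_def)

lemma abs_rademacher [simp]: "\<bar>rademacher k x\<bar> = 1"
  by (simp add: rademacher_def)

section \<open>Coordinate flips and the resulting sign families\<close>

definition flip_coord :: "nat \<Rightarrow> walsh \<Rightarrow> walsh"
  where "flip_coord i x = x(i := x i + 1)"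

lemma rademacher_flip_coord: "rademacher j (flip_coord i x) = (if j = i then - rademacher j x else rademacher j x)"
  by (cases "x i") (auto simp: rademacher_def flip_coord_def)

lemma measurable_flip_coord: "flip_coord i \<in> measurable walsh_measure walsh_measure"
proof -
  have "(\<lambda>b. b + 1) \<in> measurable (uniform_count_measure (UNIV :: bit set)) (uniform_count_measure UNIV)"
    by (auto simp: measurable_def sets_uniform_count_measure space_uniform_count_measure)
  then have "(\<lambda>x. x i + 1) \<in> measurable walsh_measure (uniform_count_measure UNIV)"
    unfolding walsh_measure_def by (rule measurable_compose[OF measurable_component_singleton, rotated]) simp
  then have "(\<lambda>x. x(i := x i + 1)) \<in> measurable walsh_measure walsh_measure"
    unfolding walsh_measure_def
    by (intro measurable_PiM_single')
       (auto simp: space_uniform_count_measure PiE_def extensional_def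
             intro: measurable_component_singleton)
  then show ?thesis
    by (simp add: flip_coord_def[abs_def])
qed

text \<open>The product measure is determined by its values on cylinders. The preimage of a cylinder
  is the cylinder whose i-th factor is translated by 1, and translation preserves
  cardinality.\<close>

lemma distr_flip_coord: "distr walsh_measure walsh_measure (flip_coord i) = walsh_measure"
  unfolding walsh_measure_def
proof (rule walsh_product.PiM_eq)
  let ?U = "\<lambda>_::nat. uniform_count_measure (UNIV :: bit set)"
  fix J :: "nat set" and F :: "nat \<Rightarrow> bit set"
  assume J: "finite J" "J \<subseteq> UNIV"
  define F' where "F' j = (if j = i then {b. b + 1 \<in> F j} else F j)" for j
  have mem: "flip_coord i x j \<in> F j \<longleftrightarrow> x j \<in> F' j" for x j
    by (simp add: flip_coord_def F'_def)
  have "flip_coord i -` prod_emb UNIV ?U J (Pi\<^sub>E J F) = prod_emb UNIV ?U J (Pi\<^sub>E J F')"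
    by (auto simp: prod_emb_iff PiE_iff mem space_uniform_count_measure)
  then have "emeasure (distr (PiM UNIV ?U) (PiM UNIV ?U) (flip_coord i)) (prod_emb UNIV ?U J (Pi\<^sub>E J F))
      = emeasure (PiM UNIV ?U) (prod_emb UNIV ?U J (Pi\<^sub>E J F'))"
    using measurable_flip_coord[of i] J
    by (subst emeasure_distr) (auto simp: walsh_measure_def space_PiM space_uniform_count_measure
        sets_uniform_count_measure intro!: sets_PiM_I)
  also have "\<dots> = (\<Prod>j\<in>J. emeasure (?U j) (F' j))"
    using J by (intro walsh_product.emeasure_PiM_emb) (auto simp: sets_uniform_count_measure)
  also have "\<dots> = (\<Prod>j\<in>J. emeasure (?U j) (F j))"
  proof (intro prod.cong refl)
    fix j
    have "card {b. b + 1 \<in> F j} = card (F j)"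
      by (rule bij_betw_same_card[of "\<lambda>b. b + 1"], rule bij_betwI[where g = "\<lambda>b. b + 1"])
        (auto simp: add.assoc)
    moreover have "emeasure (?U j) A = ennreal (card A / card (UNIV :: bit set))" for A
      by (rule emeasure_uniform_count_measure) simp_all
    ultimately show "emeasure (?U j) (F' j) = emeasure (?U j) (F j)"
      by (simp only: F'_def split: if_split) simp
  qed
  finally show "emeasure (distr (PiM UNIV ?U) (PiM UNIV ?U) (flip_coord i)) (prod_emb UNIV ?U J (Pi\<^sub>E J F))
      = (\<Prod>j\<in>J. emeasure (?U j) (F j))" .
qed simp

lemma rademacher_measurable: "rademacher k \<in> borel_measurable walsh_measure"
  using borel_measurable_continuous_onI[OF continuous_rademacher]
  by (simp add: measurable_cong_sets[OF sets_walsh refl])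

text \<open>The signs are shifted by x because the kernels are functions of x + s. For fixed x the
  shift only multiplies each sign by a constant, so flipping a coordinate of s still reverses one
  sign.\<close>

lemma sign_family_walsh: "sign_family walsh_measure (\<lambda>j s. rademacher j (x + s))"
proof (unfold_locales, goal_cases)
  case (1 i)
  show ?case
    unfolding rademacher_add by (intro borel_measurable_times rademacher_measurable borel_measurable_const)
next
  case (3 i)
  show ?case
    using measurable_flip_coord distr_flip_coord
    by (intro exI[of _ "flip_coord i"]) (auto simp: rademacher_add rademacher_flip_coord)
qed simp

abbreviation "walsh2_measure \<equiv> walsh_measure \<Otimes>\<^sub>M walsh_measure"

lemma walsh2_flip_fst:
  "(\<lambda>w. (flip_coord i (fst w), snd w)) \<in> measurable walsh2_measure walsh2_measure"
  "distr walsh2_measure walsh2_measure (\<lambda>w. (flip_coord i (fst w), snd w)) = walsh2_measure"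
proof -
  show "(\<lambda>w. (flip_coord i (fst w), snd w)) \<in> measurable walsh2_measure walsh2_measure"
    by (intro measurable_Pair measurable_compose[OF measurable_fst measurable_flip_coord] measurable_snd)
  show "distr walsh2_measure walsh2_measure (\<lambda>w. (flip_coord i (fst w), snd w)) = walsh2_measure"
    using pair_measure_distr[of "flip_coord i" walsh_measure walsh_measure "\<lambda>x. x" walsh_measure walsh_measure]
    by (simp add: measurable_flip_coord distr_flip_coord walsh.sigma_finite_measure_axioms split_beta')
qed

lemma walsh2_flip_snd:
  "(\<lambda>w. (fst w, flip_coord i (snd w))) \<in> measurable walsh2_measure walsh2_measure"
  "distr walsh2_measure walsh2_measure (\<lambda>w. (fst w, flip_coord i (snd w))) = walsh2_measure"
proof -
  show "(\<lambda>w. (fst w, flip_coord i (snd w))) \<in> measurable walsh2_measure walsh2_measure"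
    by (intro measurable_Pair measurable_compose[OF measurable_snd measurable_flip_coord] measurable_fst)
  show "distr walsh2_measure walsh2_measure (\<lambda>w. (fst w, flip_coord i (snd w))) = walsh2_measure"
    using pair_measure_distr[of "\<lambda>x. x" walsh_measure walsh_measure "flip_coord i" walsh_measure walsh_measure]
    by (simp add: measurable_flip_coord distr_flip_coord walsh.sigma_finite_measure_axioms split_beta')
qed

text \<open>The sum type merges the coordinates of both factors into one family; p is the point of
  evaluation and w the integration variable.\<close>

definition pair_sign :: "walsh \<times> walsh \<Rightarrow> nat + nat \<Rightarrow> walsh \<times> walsh \<Rightarrow> real"
  where "pair_sign p i w = (case i of Inl j \<Rightarrow> rademacher j (fst p + fst w)
           | Inr j \<Rightarrow> rademacher j (snd p + snd w))"

lemma sign_family_walsh2: "sign_family (walsh_measure \<Otimes>\<^sub>M walsh_measure) (pair_sign p)"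
proof -
  interpret P: prob_space "walsh_measure \<Otimes>\<^sub>M walsh_measure"
    by (rule walsh2.prob_space_axioms)
  show ?thesis
  proof (unfold_locales, goal_cases)
    case (1 i)
    note [measurable] = measurable_compose[OF measurable_fst rademacher_measurable]
      measurable_compose[OF measurable_snd rademacher_measurable]
    show ?case
      unfolding pair_sign_def[abs_def] rademacher_add by (cases i; simp only: sum.case; measurable)
  next
    case (2 i w)
    show ?case
      by (cases i) (auto simp: pair_sign_def)
  next
    case (3 i)
    show ?case
    proof (cases i)
      case (Inl k)
      show ?thesis
        by (intro exI[of _ "\<lambda>w. (flip_coord k (fst w), snd w)"])
           (auto simp: walsh2_flip_fst pair_sign_def Inl rademacher_add rademacher_flip_coord split: sum.splits)
    next
      case (Inr k)
      show ?thesis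
        by (intro exI[of _ "\<lambda>w. (fst w, flip_coord k (snd w))"])
           (auto simp: walsh2_flip_snd pair_sign_def Inr rademacher_add rademacher_flip_coord split: sum.splits)
    qed
  qed
qed

section \<open>Kaczmarz functions and kernels in reversed coordinates\<close>

lemma top_bit_eq:
  assumes "2 ^ k \<le> n" "n < 2 ^ Suc k"
  shows "top_bit n = k" and "{j. bit n j} = insert k {j. j < k \<and> bit n j}"
proof -
  define m where "m = n - 2 ^ k"
  have m: "n = 2 ^ k + m" "m < 2 ^ k"
    using assms by (auto simp: m_def)
  have b: "bit n j \<longleftrightarrow> j = k \<or> bit m j" for j
    using m by (simp add: bit_exp_add)
  have l: "bit m j \<Longrightarrow> j < k" for j
    using m bit_less_exp by blast
  show "{j. bit n j} = insert k {j. j < k \<and> bit n j}"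
    using b l by auto
  show "top_bit n = k"
    unfolding top_bit_def using b l by (intro Max_eqI) (auto simp: less_imp_le)
qed

text \<open>Position k stays fixed: a Kaczmarz function with leading digit k reverses only the
  Rademacher factors below the leading one.\<close>

definition bit_reversal :: "nat \<Rightarrow> nat \<Rightarrow> nat"
  where "bit_reversal k j = (if j < k then k - 1 - j else j)"

lemma inj_bit_reversal: "inj (bit_reversal k)"
  by (auto simp: inj_def bit_reversal_def split: if_splits)

lemma kaczmarz_eq_walsh_char:
  assumes "2 ^ k \<le> n" "n < 2 ^ Suc k"
  shows "kaczmarz n x = walsh_char (\<lambda>j. rademacher (bit_reversal k j) x) n"
proof -
  have "n \<noteq> 0"
    using assms(1) by (metis le_zero_eq power_not_zero zero_neq_numeral)
  moreover have "(\<Prod>j<k. rademacher (k - 1 - j) x ^ of_bool (bit n j))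
      = (\<Prod>j<k. if bit n j then rademacher (k - 1 - j) x else 1)"
    by (intro prod.cong) auto
  moreover have "\<dots> = (\<Prod>j | j < k \<and> bit n j. rademacher (bit_reversal k j) x)"
    by (subst prod.inter_filter[symmetric]) (auto simp: bit_reversal_def intro!: prod.cong)
  ultimately show ?thesis
    using top_bit_eq[OF assms] by (simp add: kaczmarz_def walsh_char_def bit_reversal_def)
qed

lemma abs_kaczmarz [simp]: "\<bar>kaczmarz n x\<bar> = 1"
  by (simp add: kaczmarz_def abs_mult abs_prod power_abs)

definition kaczmarz_kernel :: "nat \<Rightarrow> walsh \<Rightarrow> walsh \<Rightarrow> real"
  where "kaczmarz_kernel l x s = (\<Sum>n<l. kaczmarz n x * kaczmarz n s)"

lemma prod_bit_reversal: "(\<Prod>j<k. g (bit_reversal k j)) = (\<Prod>j<k. g j)"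
  using prod.nat_diff_reindex[of g k] by (simp add: bit_reversal_def)

text \<open>The value at 2^k is a hypothesis because its proof by induction on k uses this lemma for
  the preceding block. It is a product over the first k coordinates, hence unchanged by reversal,
  and every further summand is a reversed character. The end point 2^(k+1) belongs to the block
  since the kernel sums over n < l.\<close>

lemma kaczmarz_kernel_block:
  assumes "kaczmarz_kernel (2 ^ k) x s = (\<Prod>j<k. 1 + rademacher j (x + s))"
    and "2 ^ k \<le> l" "l \<le> 2 ^ Suc k"
  shows "kaczmarz_kernel l x s = dirichlet (\<lambda>j. rademacher (bit_reversal k j) (x + s)) l"
  using assms(2,3)
proof (induction l rule: dec_induct)
  case base
  show ?case
    unfolding assms(1) dirichlet_exp
    using prod_bit_reversal[of "\<lambda>j. 1 + rademacher j (x + s)" k] by (simp only:)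
next
  case (step n)
  have "kaczmarz n x * kaczmarz n s = walsh_char (\<lambda>j. rademacher (bit_reversal k j) (x + s)) n"
    unfolding rademacher_add walsh_char_mult using step by (simp add: kaczmarz_eq_walsh_char[of k])
  moreover have "kaczmarz_kernel n x s = dirichlet (\<lambda>j. rademacher (bit_reversal k j) (x + s)) n"
    by (rule step.IH) (use step in simp)
  ultimately show ?case
    unfolding kaczmarz_kernel_def dirichlet_def by (simp only: sum.lessThan_Suc)
qed

text \<open>At the end of a block the reversed kernel is again a full product, in which the order of
  the coordinates is immaterial; this starts the next block.\<close>

lemma kaczmarz_kernel_exp: "kaczmarz_kernel (2 ^ k) x s = (\<Prod>j<k. 1 + rademacher j (x + s))"
proof (induction k)
  case (Suc k)
  have "kaczmarz_kernel (2 ^ Suc k) x s = (\<Prod>j<Suc k. 1 + rademacher (bit_reversal k j) (x + s))"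
    by (subst kaczmarz_kernel_block[OF Suc.IH]) (auto simp: dirichlet_exp simp del: power_Suc)
  also have "\<dots> = (\<Prod>j<k. 1 + rademacher (bit_reversal k j) (x + s)) * (1 + rademacher k (x + s))"
    unfolding prod.lessThan_Suc by (simp add: bit_reversal_def)
  also have "(\<Prod>j<k. 1 + rademacher (bit_reversal k j) (x + s)) = (\<Prod>j<k. 1 + rademacher j (x + s))"
    by (rule prod_bit_reversal)
  finally show ?case
    by (simp only: prod.lessThan_Suc)
qed (simp add: kaczmarz_kernel_def kaczmarz_def)

lemma kaczmarz_kernel_eq_dirichlet:
  assumes "2 ^ k \<le> l" "l \<le> 2 ^ Suc k"
  shows "kaczmarz_kernel l x s = dirichlet (\<lambda>j. rademacher (bit_reversal k j) (x + s)) l"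
  by (rule kaczmarz_kernel_block[OF kaczmarz_kernel_exp assms])

lemma continuous_kaczmarz: "continuous_on UNIV (kaczmarz n)"
  unfolding kaczmarz_def[abs_def]
  by (cases "n = 0")
     (auto intro!: continuous_on_mult continuous_on_prod continuous_on_power continuous_rademacher
       continuous_on_const)

lemma bounded_measurable_continuous:
  fixes g :: "walsh \<times> walsh \<Rightarrow> real"
  assumes "continuous_on UNIV g" "\<And>w. \<bar>g w\<bar> \<le> B"
  shows "walsh2.bounded_measurable g"
  using borel_measurable_continuous_onI[OF assms(1)] assms(2)
  by (auto simp: walsh2.bounded_measurable_def measurable_cong_sets[OF sets_walsh2 refl])

lemma continuous_kaczmarz_fst: "continuous_on UNIV (\<lambda>w :: walsh \<times> walsh. kaczmarz n (fst w))"
  and continuous_kaczmarz_snd: "continuous_on UNIV (\<lambda>w :: walsh \<times> walsh. kaczmarz n (snd w))"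
  by (rule continuous_on_compose2[OF continuous_kaczmarz]; auto intro: continuous_intros)+

lemma bounded_measurable_kaczmarz:
  "walsh2.bounded_measurable (\<lambda>w. kaczmarz n (fst w))"
  "walsh2.bounded_measurable (\<lambda>w. kaczmarz n (snd w))"
  by (auto intro!: bounded_measurable_continuous[of _ 1] continuous_kaczmarz_fst continuous_kaczmarz_snd)

section \<open>Partial sums as kernel integrals and their exponential means\<close>

lemma kaczmarz_coeff_eq:
  "kaczmarz_coeff f k i = (\<integral>w. f w * kaczmarz k (fst w) * kaczmarz i (snd w) \<partial>walsh2_measure)"
  by (simp add: kaczmarz_coeff_def split_beta')

lemma kaczmarz_sum_eq_integral:
  assumes f: "walsh2.bounded_measurable f"
  shows "kaczmarz_sum l m f p = (\<integral>w. f w * kaczmarz_kernel l (fst p) (fst w)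
            * kaczmarz_kernel m (snd p) (snd w) \<partial>walsh2_measure)"
proof -
  note bmi = walsh2.bounded_measurable_intros bounded_measurable_kaczmarz f
  have "f w * kaczmarz_kernel l (fst p) (fst w) * kaczmarz_kernel m (snd p) (snd w)
    = (\<Sum>k<l. \<Sum>i<m. f w * kaczmarz k (fst w) * kaczmarz i (snd w) * (kaczmarz k (fst p) * kaczmarz i (snd p)))" for w
    unfolding kaczmarz_kernel_def mult.assoc
    unfolding sum_product
    unfolding sum_distrib_left by (intro sum.cong refl) (simp add: mult_ac)
  then have "(\<integral>w. f w * kaczmarz_kernel l (fst p) (fst w) * kaczmarz_kernel m (snd p) (snd w) \<partial>walsh2_measure)
    = (\<integral>w. (\<Sum>k<l. \<Sum>i<m. f w * kaczmarz k (fst w) * kaczmarz i (snd w)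
            * (kaczmarz k (fst p) * kaczmarz i (snd p))) \<partial>walsh2_measure)"
    by (simp only:)
  also have "\<dots> = (\<Sum>k<l. \<Sum>i<m. kaczmarz_coeff f k i * (kaczmarz k (fst p) * kaczmarz i (snd p)))"
    unfolding kaczmarz_coeff_eq
    by (subst Bochner_Integration.integral_sum, intro walsh2.bounded_measurable_integrable bmi,
        rule sum.cong[OF refl],
        subst Bochner_Integration.integral_sum, intro walsh2.bounded_measurable_integrable bmi,
        rule sum.cong[OF refl], rule Bochner_Integration.integral_mult_left_zero)
  finally show ?thesis
    by (simp add: kaczmarz_sum_def split_beta mult.assoc)
qed

lemma kaczmarz_sum_eq_dirichlet:
  assumes f: "walsh2.bounded_measurable f" and l: "2 ^ k \<le> l" "l \<le> 2 ^ Suc k"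
  shows "kaczmarz_sum l l f p = (\<integral>w. f w * dirichlet (\<lambda>j. pair_sign p ((Inl \<circ> bit_reversal k) j) w) l
            * dirichlet (\<lambda>j. pair_sign p ((Inr \<circ> bit_reversal k) j) w) l \<partial>walsh2_measure)"
  unfolding kaczmarz_sum_eq_integral[OF f] kaczmarz_kernel_eq_dirichlet[OF l]
  by (simp add: pair_sign_def)

lemma sum_growth_kaczmarz_block:
  assumes f: "walsh2.bounded_measurable f" "\<And>w. \<bar>f w\<bar> \<le> 1"
  shows "(\<Sum>l\<in>{2 ^ k..<2 ^ Suc k}. growth_base powr sqrt \<bar>kaczmarz_sum l l f p\<bar>) \<le> growth_const * 2 ^ Suc k"
proof -
  interpret S: sign_family walsh2_measure "pair_sign p"
    by (rule sign_family_walsh2)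
  let ?I = "\<lambda>l. \<integral>w. f w * dirichlet (\<lambda>j. pair_sign p ((Inl \<circ> bit_reversal k) j) w) l
            * dirichlet (\<lambda>j. pair_sign p ((Inr \<circ> bit_reversal k) j) w) l \<partial>walsh2_measure"
  have "(\<Sum>l\<in>{2 ^ k..<2 ^ Suc k}. growth_base powr sqrt \<bar>kaczmarz_sum l l f p\<bar>)
      = (\<Sum>l\<in>{2 ^ k..<2 ^ Suc k}. growth_base powr sqrt \<bar>?I l\<bar>)"
  proof (intro sum.cong refl)
    fix l :: nat
    assume "l \<in> {2 ^ k..<2 ^ Suc k}"
    then have "kaczmarz_sum l l f p = ?I l"
      by (intro kaczmarz_sum_eq_dirichlet f) (auto simp del: power_Suc)
    then show "growth_base powr sqrt \<bar>kaczmarz_sum l l f p\<bar> = growth_base powr sqrt \<bar>?I l\<bar>"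
      by (simp only:)
  qed
  \<comment> \<open>For l < 2^k the integral with the reversal of block k need not be a Kaczmarz
    sum; these nonnegative terms are added so that \<open>sum_growth_le\<close> applies.\<close>
  also have "\<dots> \<le> (\<Sum>l<2 ^ Suc k. growth_base powr sqrt \<bar>?I l\<bar>)"
    by (intro sum_mono2) auto
  also have "\<dots> \<le> growth_const * 2 ^ Suc k"
    using inj_bit_reversal[of k] by (intro S.sum_growth_le f inj_compose) auto
  finally show ?thesis .
qed

lemma sum_growth_kaczmarz:
  assumes f: "walsh2.bounded_measurable f" "\<And>w. \<bar>f w\<bar> \<le> 1"
  shows "(\<Sum>l=1..n. growth_base powr sqrt \<bar>kaczmarz_sum l l f p\<bar>) \<le> 4 * growth_const * n"
proof (cases "n = 0")
  case False
  let ?g = "\<lambda>l. growth_base powr sqrt \<bar>kaczmarz_sum l l f p\<bar>"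
  \<comment> \<open>The bounds of the blocks k < K add up geometrically. Since 2^K \<le> n <
    2^(K+1), the first K + 1 blocks cover all indices up to n, whence the factor 4.\<close>
  have *: "(\<Sum>l\<in>{1..<2 ^ K}. ?g l) \<le> growth_const * 2 ^ Suc K" for K
  proof (induction K)
    case 0
    show ?case using growth_const_pos by simp
  next
    case (Suc K)
    have "(\<Sum>l\<in>{1..<2 ^ Suc K}. ?g l) = (\<Sum>l\<in>{1..<2 ^ K}. ?g l) + (\<Sum>l\<in>{2 ^ K..<2 ^ Suc K}. ?g l)"
      by (intro sum.atLeastLessThan_concat[symmetric]) auto
    then show ?case
      using Suc sum_growth_kaczmarz_block[OF f, of p K] by simp
  qed
  obtain K where K: "2 ^ K \<le> n" "n < 2 ^ Suc K"
    using False ex_power_ivl1[of 2 n] by auto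
  have "(\<Sum>l=1..n. ?g l) \<le> (\<Sum>l\<in>{1..<2 ^ Suc K}. ?g l)"
    using K by (intro sum_mono2) auto
  also have "\<dots> \<le> growth_const * 2 ^ Suc (Suc K)"
    by (rule *)
  also have "\<dots> = 4 * growth_const * real (2 ^ K)"
    by simp
  also have "\<dots> \<le> 4 * growth_const * n"
  proof (intro mult_left_mono)
    show "real (2 ^ K) \<le> real n"
      by (rule of_nat_mono) (rule K(1))
  qed (use growth_const_pos in simp)
  finally show ?thesis .
qed simp

lemma kaczmarz_kernel_bounded_measurable:
  "walsh2.bounded_measurable (\<lambda>w. kaczmarz_kernel l x (fst w))"
  "walsh2.bounded_measurable (\<lambda>w. kaczmarz_kernel l x (snd w))"
  unfolding kaczmarz_kernel_def
  by (intro walsh2.bounded_measurable_intros bounded_measurable_kaczmarz)+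

lemma kaczmarz_sum_add:
  assumes "walsh2.bounded_measurable f" "walsh2.bounded_measurable g"
  shows "kaczmarz_sum l m (\<lambda>w. f w + g w) p = kaczmarz_sum l m f p + kaczmarz_sum l m g p"
proof -
  note bmi = walsh2.bounded_measurable_intros kaczmarz_kernel_bounded_measurable assms
  show ?thesis
    unfolding kaczmarz_sum_eq_integral[OF assms(1)] kaczmarz_sum_eq_integral[OF assms(2)]
      kaczmarz_sum_eq_integral[OF walsh2.bounded_measurable_add[OF assms]] distrib_right
    by (intro Bochner_Integration.integral_add walsh2.bounded_measurable_integrable bmi)
qed

lemma kaczmarz_sum_cmult:
  "kaczmarz_sum l m (\<lambda>w. c * f w) p = c * kaczmarz_sum l m f p"
proof -
  have "kaczmarz_coeff (\<lambda>w. c * f w) k i = c * kaczmarz_coeff f k i" for k i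
    by (simp add: kaczmarz_coeff_eq mult.assoc)
  then show ?thesis
    by (simp add: kaczmarz_sum_def split_beta sum_distrib_left mult.assoc)
qed

text \<open>Dividing h by s^2 brings its norm below 1 and divides the root by s. A small remainder
  thus tolerates a large constant in the exponent.\<close>

lemma sum_growth_kaczmarz_scaled:
  assumes h: "walsh2.bounded_measurable h" "\<And>w. \<bar>h w\<bar> \<le> s\<^sup>2" and s: "0 < s"
  shows "(\<Sum>l=1..n. exp (ln growth_base * (sqrt \<bar>kaczmarz_sum l l h p\<bar> / s))) \<le> 4 * growth_const * n"
proof -
  define g where "g w = (1 / s\<^sup>2) * h w" for w
  have "walsh2.bounded_measurable g"
    unfolding g_def by (intro walsh2.bounded_measurable_intros h)
  moreover have "\<bar>g w\<bar> \<le> 1" for w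
    using h(2)[of w] s by (simp add: g_def abs_mult divide_le_eq_1)
  ultimately have "(\<Sum>l=1..n. growth_base powr sqrt \<bar>kaczmarz_sum l l g p\<bar>) \<le> 4 * growth_const * n"
    by (rule sum_growth_kaczmarz)
  moreover have "growth_base powr sqrt \<bar>kaczmarz_sum l l g p\<bar>
      = exp (ln growth_base * (sqrt \<bar>kaczmarz_sum l l h p\<bar> / s))" for l
    using growth_base_gt_1 s unfolding g_def[abs_def] kaczmarz_sum_cmult
    by (simp add: powr_def abs_mult real_sqrt_mult real_sqrt_divide mult.commute)
  ultimately show ?thesis
    by simp
qed

section \<open>Approximation by functions of finitely many coordinates\<close>

definition truncate :: "nat \<Rightarrow> walsh \<times> walsh \<Rightarrow> walsh \<times> walsh"
  where "truncate N w = (\<lambda>j. if j < N then fst w j else 0, \<lambda>j. if j < N then snd w j else 0)"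

lemma continuous_fst_coord: "continuous_on UNIV (\<lambda>w::walsh \<times> walsh. fst w j)"
  by (rule continuous_on_product_then_coordinatewise[OF continuous_on_fst[OF continuous_on_id]])

lemma continuous_snd_coord: "continuous_on UNIV (\<lambda>w::walsh \<times> walsh. snd w j)"
  by (rule continuous_on_product_then_coordinatewise[OF continuous_on_snd[OF continuous_on_id]])

lemma continuous_truncate: "continuous_on UNIV (truncate N)"
proof -
  have 1: "continuous_on UNIV (\<lambda>w::walsh \<times> walsh. \<lambda>j. if j < N then fst w j else 0)"
  proof (rule continuous_on_coordinatewise_then_product)
    show "continuous_on UNIV (\<lambda>w::walsh \<times> walsh. if j < N then fst w j else 0)" for j
      by (cases "j < N") (auto simp: continuous_fst_coord)
  qed
  have 2: "continuous_on UNIV (\<lambda>w::walsh \<times> walsh. \<lambda>j. if j < N then snd w j else 0)"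
  proof (rule continuous_on_coordinatewise_then_product)
    show "continuous_on UNIV (\<lambda>w::walsh \<times> walsh. if j < N then snd w j else 0)" for j
      by (cases "j < N") (auto simp: continuous_snd_coord)
  qed
  show ?thesis
    unfolding truncate_def[abs_def] by (intro continuous_on_Pair 1 2)
qed

lemma compact_UNIV_walsh: "compact (UNIV :: walsh set)"
proof -
  have "compact_space (euclidean :: bit topology)"
    by (simp add: compact_space_def finite_imp_compact)
  then have "compact_space (product_topology (\<lambda>_::nat. euclidean :: bit topology) UNIV)"
    by (simp add: compact_space_product_topology)
  then show ?thesis
    by (simp add: euclidean_product_topology compact_space_def)
qed

lemma compact_UNIV_walsh2: "compact (UNIV :: (walsh \<times> walsh) set)"
  using compact_Times[OF compact_UNIV_walsh compact_UNIV_walsh] by simp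

lemma open_walsh_contains_cylinder:
  assumes "open (U :: walsh set)" "x \<in> U"
  shows "\<exists>N. \<forall>y. (\<forall>j<N. y j = x j) \<longrightarrow> y \<in> U"
proof -
  obtain X where X: "x \<in> Pi\<^sub>E UNIV X" "finite {i. X i \<noteq> (UNIV :: bit set)}" "Pi\<^sub>E UNIV X \<subseteq> U"
    using product_topology_open_contains_basis[of "\<lambda>_. euclidean" UNIV U x] assms
    by (auto simp: open_fun_def)
  obtain N where N: "\<And>i. X i \<noteq> UNIV \<Longrightarrow> i < N"
    using finite_nat_bounded[OF X(2)] by auto
  have "y \<in> U" if y: "\<forall>j<N. y j = x j" for y
  proof -
    have "y j \<in> X j" for j
      using X(1) N[of j] y by (cases "j < N") (auto simp: PiE_iff)
    then show ?thesis
      using X(3) by (auto simp: PiE_iff)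
  qed
  then show ?thesis by blast
qed

text \<open>By compactness finitely many cylinders, on each of which f stays within \<epsilon>/2 of
  its value at a centre, cover the square. If N is at least the length of each of them, truncation
  moves no point out of its cylinder.\<close>

lemma uniform_truncate:
  fixes f :: "walsh \<times> walsh \<Rightarrow> real"
  assumes f: "continuous_on UNIV f" and \<epsilon>: "0 < \<epsilon>"
  shows "\<exists>N. \<forall>w. \<bar>f w - f (truncate N w)\<bar> \<le> \<epsilon>"
proof -
  define Z where "Z N p = {w :: walsh \<times> walsh. \<forall>j<N. fst w j = fst p j \<and> snd w j = snd p j}" for N p
  have "\<exists>N. \<forall>w\<in>Z N p. \<bar>f w - f p\<bar> < \<epsilon> / 2" for p
  proof -
    have "open (f -` ball (f p) (\<epsilon> / 2))"
      using f by (intro open_vimage) auto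
    moreover have "p \<in> f -` ball (f p) (\<epsilon> / 2)"
      using \<epsilon> by simp
    ultimately obtain A B where AB: "open A" "open B" "p \<in> A \<times> B" "A \<times> B \<subseteq> f -` ball (f p) (\<epsilon> / 2)"
      by (rule open_prod_elim)
    have pAB: "fst p \<in> A" "snd p \<in> B"
      using AB(3) by (simp_all add: mem_Times_iff)
    obtain N1 where N1: "\<And>y. \<forall>j<N1. y j = fst p j \<Longrightarrow> y \<in> A"
      using open_walsh_contains_cylinder[OF AB(1) pAB(1)] by blast
    obtain N2 where N2: "\<And>y. \<forall>j<N2. y j = snd p j \<Longrightarrow> y \<in> B"
      using open_walsh_contains_cylinder[OF AB(2) pAB(2)] by blast
    have "\<bar>f w - f p\<bar> < \<epsilon> / 2" if "w \<in> Z (max N1 N2) p" for w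
    proof -
      have "w \<in> A \<times> B"
        using that N1[of "fst w"] N2[of "snd w"] by (auto simp: Z_def mem_Times_iff)
      then have "f w \<in> ball (f p) (\<epsilon> / 2)"
        using AB(4) by blast
      then show ?thesis
        by (simp add: dist_real_def abs_minus_commute)
    qed
    then show ?thesis by blast
  qed
  then have "\<exists>N. \<forall>p. \<forall>w\<in>Z (N p) p. \<bar>f w - f p\<bar> < \<epsilon> / 2"
    by (intro choice allI)
  then obtain N where N: "\<forall>p. \<forall>w\<in>Z (N p) p. \<bar>f w - f p\<bar> < \<epsilon> / 2" ..
  have "open (Z n p)" for n p
  proof -
    have 1: "open ((\<lambda>w::walsh \<times> walsh. fst w j) -` {fst p j})" for j
      by (rule open_vimage) (auto simp: open_bit_def continuous_fst_coord)
    have 2: "open ((\<lambda>w::walsh \<times> walsh. snd w j) -` {snd p j})" for j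
      by (rule open_vimage) (auto simp: open_bit_def continuous_snd_coord)
    have "Z n p = (\<Inter>j\<in>{..<n}. (\<lambda>w. fst w j) -` {fst p j} \<inter> (\<lambda>w. snd w j) -` {snd p j})"
      by (auto simp: Z_def)
    then show ?thesis
      using 1 2 by (auto intro!: open_INT open_Int)
  qed
  moreover have "UNIV \<subseteq> (\<Union>p\<in>UNIV. Z (N p) p)"
    by (auto simp: Z_def)
  ultimately obtain D where D: "finite D" "UNIV \<subseteq> (\<Union>p\<in>D. Z (N p) p)"
    using compactE_image[OF compact_UNIV_walsh2, of UNIV "\<lambda>p. Z (N p) p"] by (metis (no_types, lifting))
  define n where "n = Max (N ` D)"
  have "\<bar>f w - f (truncate n w)\<bar> \<le> \<epsilon>" for w
  proof -
    obtain p where p: "p \<in> D" "w \<in> Z (N p) p"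
      using D(2) by blast
    then have "N p \<le> n"
      using D(1) by (auto simp: n_def)
    then have "truncate n w \<in> Z (N p) p"
      using p(2) by (auto simp: Z_def truncate_def)
    then show ?thesis
      using N[rule_format, OF p(2)] N[rule_format, of "truncate n w" p] by linarith
  qed
  then show ?thesis by blast
qed

lemma walsh2_integral_flip:
  fixes g :: "walsh \<times> walsh \<Rightarrow> real"
  assumes g: "walsh2.bounded_measurable g"
  shows "(\<integral>w. g (flip_coord i (fst w), snd w) \<partial>walsh2_measure) = (\<integral>w. g w \<partial>walsh2_measure)"
    and "(\<integral>w. g (fst w, flip_coord i (snd w)) \<partial>walsh2_measure) = (\<integral>w. g w \<partial>walsh2_measure)"
  using walsh2_flip_fst[of i] walsh2_flip_snd[of i] g
    integral_distr[of "\<lambda>w. (flip_coord i (fst w), snd w)" walsh2_measure walsh2_measure g]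
    integral_distr[of "\<lambda>w. (fst w, flip_coord i (snd w))" walsh2_measure walsh2_measure g]
  by (auto simp: walsh2.bounded_measurable_def)

text \<open>The leading Rademacher factor is the only one with index \<open>top_bit n\<close>; all
  others have smaller indices.\<close>

lemma kaczmarz_flip_top:
  assumes "2 ^ N \<le> n"
  shows "N \<le> top_bit n" and "kaczmarz n (flip_coord (top_bit n) s) = - kaczmarz n s"
proof -
  have n: "1 \<le> n"
    using assms by (metis le_trans one_le_numeral one_le_power)
  then obtain k where k: "2 ^ k \<le> n" "n < 2 ^ Suc k"
    using ex_power_ivl1[of 2 n] by auto
  then have "(2::nat) ^ N < 2 ^ Suc k"
    using assms by linarith
  then show "N \<le> top_bit n"
    using top_bit_eq(1)[OF k] by (simp only: power_strict_increasing_iff one_less_numeral_iff semiring_norm less_Suc_eq_le)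
  have "(\<Prod>j<top_bit n. rademacher (top_bit n - 1 - j) (flip_coord (top_bit n) s) ^ of_bool (bit n j))
      = (\<Prod>j<top_bit n. rademacher (top_bit n - 1 - j) s ^ of_bool (bit n j))"
    by (intro prod.cong refl) (auto simp: rademacher_flip_coord)
  then show "kaczmarz n (flip_coord (top_bit n) s) = - kaczmarz n s"
    using n by (simp add: kaczmarz_def rademacher_flip_coord)
qed

lemma truncate_flip:
  assumes "N \<le> i"
  shows "truncate N (flip_coord i (fst w), snd w) = truncate N w"
    and "truncate N (fst w, flip_coord i (snd w)) = truncate N w"
  using assms by (auto simp: truncate_def flip_coord_def fun_eq_iff)

text \<open>Flipping the leading coordinate of the large index, which is at least N, preserves the
  truncated function and negates the character.\<close>

lemma kaczmarz_coeff_truncate: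
  assumes f: "walsh2.bounded_measurable (\<lambda>w. f (truncate N w))"
    and ki: "2 ^ N \<le> k \<or> 2 ^ N \<le> i"
  shows "kaczmarz_coeff (\<lambda>w. f (truncate N w)) k i = 0"
proof -
  define g where "g w = f (truncate N w) * kaczmarz k (fst w) * kaczmarz i (snd w)" for w
  have g: "walsh2.bounded_measurable g"
    unfolding g_def by (intro walsh2.bounded_measurable_intros bounded_measurable_kaczmarz f)
  have "(\<integral>w. g w \<partial>walsh2_measure) = 0"
    using ki
  proof
    assume "2 ^ N \<le> k"
    note k = kaczmarz_flip_top[OF this]
    have "(\<integral>w. g (flip_coord (top_bit k) (fst w), snd w) \<partial>walsh2_measure) = (\<integral>w. - g w \<partial>walsh2_measure)"
      by (simp add: g_def k truncate_flip)
    then show ?thesis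
      using walsh2_integral_flip(1)[OF g] by simp
  next
    assume "2 ^ N \<le> i"
    note i = kaczmarz_flip_top[OF this]
    have "(\<integral>w. g (fst w, flip_coord (top_bit i) (snd w)) \<partial>walsh2_measure) = (\<integral>w. - g w \<partial>walsh2_measure)"
      by (simp add: g_def i truncate_flip)
    then show ?thesis
      using walsh2_integral_flip(2)[OF g] by simp
  qed
  then show ?thesis
    by (simp add: kaczmarz_coeff_eq g_def)
qed

lemma kaczmarz_kernel_exp_eq_0:
  assumes "j < N" "x j \<noteq> s j"
  shows "kaczmarz_kernel (2 ^ N) x s = 0"
proof -
  have "1 + rademacher j (x + s) = 0"
    using assms(2) unfolding rademacher_add by (cases "x j"; cases "s j") (auto simp: rademacher_def)
  then show ?thesis
    using assms(1) unfolding kaczmarz_kernel_exp by (intro prod_zero) auto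
qed

lemma integral_kaczmarz_kernel_exp:
  "(\<integral>w. kaczmarz_kernel (2 ^ N) (fst p) (fst w) * kaczmarz_kernel (2 ^ N) (snd p) (snd w) \<partial>walsh2_measure) = 1"
proof -
  interpret S: sign_family walsh2_measure "pair_sign p"
    by (rule sign_family_walsh2)
  have "kaczmarz_kernel (2 ^ N) (fst p) (fst w) * kaczmarz_kernel (2 ^ N) (snd p) (snd w)
      = (\<Prod>i\<in>Inl ` {..<N} \<union> Inr ` {..<N}. 1 + pair_sign p i w)" for w
    unfolding kaczmarz_kernel_exp
    by (subst prod.union_disjoint) (auto simp: prod.reindex pair_sign_def)
  then show ?thesis
    using S.integral_prod_one_plus[of "Inl ` {..<N} \<union> Inr ` {..<N}"] by (simp only:) simp
qed

text \<open>Coefficients with an index at least 2^N vanish, so the sum equals the one of order 2^N.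
  Its kernel has integral 1 and is supported on the cylinder around p, where the truncated function
  is constant.\<close>

lemma kaczmarz_sum_truncate:
  assumes f: "walsh2.bounded_measurable (\<lambda>w. f (truncate N w))" and l: "2 ^ N \<le> l"
  shows "kaczmarz_sum l l (\<lambda>w. f (truncate N w)) p = f (truncate N p)"
proof -
  let ?P = "\<lambda>w. f (truncate N w)"
  let ?t = "\<lambda>k i. kaczmarz_coeff ?P k i * kaczmarz k (fst p) * kaczmarz i (snd p)"
  have "kaczmarz_sum l l ?P p = (\<Sum>k<l. \<Sum>i<l. ?t k i)"
    by (simp add: kaczmarz_sum_def split_beta)
  also have "\<dots> = (\<Sum>k<2 ^ N. \<Sum>i<l. ?t k i)"
    using l by (intro sum.mono_neutral_right) (auto simp: kaczmarz_coeff_truncate[OF f] intro!: sum.neutral)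
  also have "\<dots> = (\<Sum>k<2 ^ N. \<Sum>i<2 ^ N. ?t k i)"
    using l by (intro sum.cong refl sum.mono_neutral_right) (auto simp: kaczmarz_coeff_truncate[OF f])
  also have "\<dots> = kaczmarz_sum (2 ^ N) (2 ^ N) ?P p"
    by (simp add: kaczmarz_sum_def split_beta)
  also have "\<dots> = (\<integral>w. ?P w * kaczmarz_kernel (2 ^ N) (fst p) (fst w)
            * kaczmarz_kernel (2 ^ N) (snd p) (snd w) \<partial>walsh2_measure)"
    by (rule kaczmarz_sum_eq_integral[OF f])
  also have "\<dots> = (\<integral>w. f (truncate N p) * (kaczmarz_kernel (2 ^ N) (fst p) (fst w)
            * kaczmarz_kernel (2 ^ N) (snd p) (snd w)) \<partial>walsh2_measure)"
  proof (intro Bochner_Integration.integral_cong refl)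
    fix w
    show "?P w * kaczmarz_kernel (2 ^ N) (fst p) (fst w) * kaczmarz_kernel (2 ^ N) (snd p) (snd w)
      = f (truncate N p) * (kaczmarz_kernel (2 ^ N) (fst p) (fst w) * kaczmarz_kernel (2 ^ N) (snd p) (snd w))"
    proof (cases "truncate N w = truncate N p")
      case False
      then obtain j where "j < N" "fst p j \<noteq> fst w j \<or> snd p j \<noteq> snd w j"
        by (auto simp: truncate_def fun_eq_iff split: if_splits)
      then show ?thesis
        using kaczmarz_kernel_exp_eq_0 by auto
    qed simp
  qed
  also have "\<dots> = f (truncate N p)"
    by (simp add: integral_kaczmarz_kernel_exp)
  finally show ?thesis .
qed

text \<open>A crude bound, meant for the finitely many l below the truncation threshold.\<close>

lemma abs_kaczmarz_sum_le:
  assumes f: "walsh2.bounded_measurable f" "\<And>w. \<bar>f w\<bar> \<le> B"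
  shows "\<bar>kaczmarz_sum l l f p\<bar> \<le> (real l)\<^sup>2 * B"
proof -
  note bmi = walsh2.bounded_measurable_intros bounded_measurable_kaczmarz f(1)
  have "\<bar>kaczmarz_coeff f k i\<bar> \<le> B" for k i
  proof -
    have "\<bar>kaczmarz_coeff f k i\<bar> \<le> (\<integral>w. \<bar>f w * kaczmarz k (fst w) * kaczmarz i (snd w)\<bar> \<partial>walsh2_measure)"
      unfolding kaczmarz_coeff_eq by (rule integral_abs_bound)
    also have "\<dots> \<le> (\<integral>w. B \<partial>walsh2_measure)"
      using f(2) by (intro integral_mono walsh2.bounded_measurable_integrable bmi) (simp add: abs_mult)
    finally show ?thesis
      by (simp add: walsh2.prob_space)
  qed
  then have "\<bar>kaczmarz_sum l l f p\<bar> \<le> (\<Sum>k<l. \<Sum>i<l. B)"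
    unfolding kaczmarz_sum_def split_beta
    by (intro order_trans[OF sum_abs] sum_mono) (auto intro!: order_trans[OF sum_abs] sum_mono simp: abs_mult)
  then show ?thesis
    by (simp add: power2_eq_square)
qed

section \<open>Exponential summability\<close>

text \<open>Convexity of exp between 0 and y. It turns a bounded mean of exp y into a mean of order
  t for exp (t y) - 1.\<close>

lemma exp_scale_le:
  fixes t y :: real
  assumes "0 \<le> t" "t \<le> 1"
  shows "exp (t * y) - 1 \<le> t * exp y"
proof -
  have "exp ((1 - t) *\<^sub>R 0 + t *\<^sub>R y) \<le> (1 - t) * exp 0 + t * exp y"
    using assms by (intro convex_onD[OF exp_convex]) auto
  then show ?thesis
    using assms by (simp add: algebra_simps)
qed

text \<open>Near 0 the limit gives \<phi> < \<eta>, for large u the limsup gives a multiple of the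
  root, and in between monotonicity bounds \<phi> by a constant while the root stays away from
  0.\<close>

lemma Psi_le_sqrt:
  assumes \<phi>: "\<phi> \<in> Psi" and lim: "Limsup at_top (\<lambda>u. ereal (\<phi> u / sqrt u)) < \<infinity>" and \<eta>: "0 < \<eta>"
  shows "\<exists>C\<ge>0. \<forall>u\<ge>0. \<phi> u \<le> \<eta> + C * sqrt u"
proof -
  obtain c where "Limsup at_top (\<lambda>u. ereal (\<phi> u / sqrt u)) < ereal c"
    using ereal_dense2[OF lim] by blast
  then have "eventually (\<lambda>u. ereal (\<phi> u / sqrt u) < ereal c) at_top"
    by (rule Limsup_lessD)
  then obtain U0 where U0: "\<And>u. U0 \<le> u \<Longrightarrow> \<phi> u / sqrt u < c"
    by (auto simp: eventually_at_top_linorder)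
  define U where "U = max U0 1"
  have nn: "0 \<le> \<phi> u" if "0 \<le> u" for u
    using \<phi> that by (auto simp: Psi_def)
  have mono: "\<phi> u \<le> \<phi> v" if "0 \<le> u" "u \<le> v" for u v
    using \<phi> that by (auto simp: Psi_def mono_on_def)
  have "(\<phi> \<longlongrightarrow> 0) (at_right 0)"
    using \<phi> by (simp add: Psi_def)
  then have "eventually (\<lambda>u. \<phi> u < \<eta>) (at_right 0)"
    using \<eta> by (rule order_tendstoD)
  then obtain d where d: "0 < d" "\<And>u. 0 < u \<Longrightarrow> u < d \<Longrightarrow> \<phi> u < \<eta>"
    by (auto simp: eventually_at_right_field)
  define C where "C = max 0 c + \<phi> U / sqrt d"
  have U: "0 \<le> \<phi> U" "1 \<le> U"
    by (auto simp: U_def intro: nn)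
  have "\<phi> u \<le> \<eta> + C * sqrt u" if u: "0 \<le> u" for u
  proof -
    have C: "0 \<le> max 0 c * sqrt u" "0 \<le> \<phi> U / sqrt d * sqrt u"
      using u d U by simp_all
    consider "u = 0" | "0 < u" "u < d" | "d \<le> u" "u \<le> U" | "U \<le> u"
      using u by linarith
    then show ?thesis
    proof cases
      case 1
      then show ?thesis using \<phi> \<eta> by (simp add: Psi_def)
    next
      case 2
      then show ?thesis using d(2)[of u] C unfolding C_def distrib_right by linarith
    next
      case 3
      have "\<phi> u \<le> \<phi> U * (sqrt u / sqrt d)"
        using mono[OF u 3(2)] U 3 d mult_left_mono[of 1 "sqrt u / sqrt d" "\<phi> U"] by simp
      then show ?thesis using C \<eta> unfolding C_def distrib_right by simp
    next
      case 4
      then have "\<phi> u < c * sqrt u"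
        using U0[of u] U by (simp add: U_def divide_less_eq)
      also have "\<dots> \<le> max 0 c * sqrt u"
        using u by (intro mult_right_mono) auto
      finally show ?thesis using C \<eta> unfolding C_def distrib_right by simp
    qed
  qed
  moreover have "0 \<le> C"
    using U d by (simp add: C_def)
  ultimately show ?thesis by blast
qed

lemma sup_norm_le:
  assumes "\<And>p. \<bar>g p\<bar> \<le> d"
  shows "sup_norm g \<le> d" "0 \<le> sup_norm g"
proof -
  show "sup_norm g \<le> d"
    unfolding sup_norm_def using assms by (intro cSUP_least) auto
  have "\<bar>g undefined\<bar> \<le> sup_norm g"
    unfolding sup_norm_def using assms by (intro cSUP_upper) (auto intro!: bdd_aboveI)
  then show "0 \<le> sup_norm g"
    by linarith
qed

text \<open>Split f into a truncated part, reproduced exactly by the partial sums of order at least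
  2^N, and a remainder h of norm at most s^2. Then only the partial sums of h and h itself matter,
  and for small s the exponent is a small multiple t of one with bounded exponential mean. The
  finitely many smaller orders disappear in the average.\<close>

lemma exponential_summability:
  fixes f :: "walsh \<times> walsh \<Rightarrow> real"
  assumes \<phi>: "\<phi> \<in> Psi" and lim: "Limsup at_top (\<lambda>u. ereal (\<phi> u / sqrt u)) < \<infinity>"
    and f: "continuous_on UNIV f"
  shows "(\<lambda>n. sup_norm (\<lambda>p. 1 / real n *
            (\<Sum>l=1..n. (exp (\<phi> \<bar>kaczmarz_sum l l f p - f p\<bar>) - 1)))) \<longlonglongrightarrow> 0"
proof (rule LIMSEQ_I)
  fix \<delta> :: real
  assume \<delta>: "0 < \<delta>"
  have nn: "0 \<le> \<phi> u" if "0 \<le> u" for u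
    using \<phi> that by (auto simp: Psi_def)
  have mono: "\<phi> u \<le> \<phi> v" if "0 \<le> u" "u \<le> v" for u v
    using \<phi> that by (auto simp: Psi_def mono_on_def)
  obtain B where B: "\<And>w. \<bar>f w\<bar> \<le> B"
    using compact_imp_bounded[OF compact_continuous_image[OF f compact_UNIV_walsh2]]
    by (auto simp: bounded_iff)
  define A where "A = ln growth_base"
  have A: "0 < A"
    using growth_base_gt_1 by (simp add: A_def)
  \<comment> \<open>Three quarters of \<delta> are spent: one on D - 1, one on the mean of the
    exponentials, one on the orders below 2^N.\<close>
  define D where "D = 1 + \<delta> / 4"
  have D: "1 < D"
    using \<delta> by (simp add: D_def)
  define \<eta> where "\<eta> = ln D / 2"
  have \<eta>: "0 < \<eta>"
    using D by (simp add: \<eta>_def)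
  obtain C where C: "0 \<le> C" "\<And>u. 0 \<le> u \<Longrightarrow> \<phi> u \<le> \<eta> + C * sqrt u"
    using Psi_le_sqrt[OF \<phi> lim \<eta>] by blast
  \<comment> \<open>The three bounds give in turn C s \<le> \<eta>, so that \<eta> + C s \<le> ln D;
    t \<le> 1; and a mean below \<delta>/4. Dividing by C + 1 covers C = 0.\<close>
  define s where "s = min (\<eta> / (C + 1)) (min (A / (C + 1)) (\<delta> / 4 * A / (D * (4 * growth_const) * (C + 1))))"
  have s: "0 < s"
    using \<eta> C(1) A D \<delta> growth_const_pos by (simp add: s_def)
  \<comment> \<open>Chosen so that \<open>t * y l p\<close> below equals C times the root of the
    modulus of the partial sum of h.\<close>
  define t where "t = C * s / A"
  have Cs: "C * s \<le> (C + 1) * s"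
    using s by simp
  have "(C + 1) * s \<le> (C + 1) * (\<eta> / (C + 1))"
    using C(1) by (intro mult_left_mono) (auto simp: s_def)
  with Cs have s1: "C * s \<le> \<eta>"
    using C(1) by simp
  have "(C + 1) * s \<le> (C + 1) * (A / (C + 1))"
    using C(1) by (intro mult_left_mono) (auto simp: s_def)
  with Cs have "C * s \<le> A"
    using C(1) by simp
  then have t: "0 \<le> t" "t \<le> 1"
    using A C(1) s by (simp_all add: t_def)
  have "(C + 1) * s \<le> (C + 1) * (\<delta> / 4 * A / (D * (4 * growth_const) * (C + 1)))"
    using C(1) by (intro mult_left_mono) (auto simp: s_def)
  with Cs have "C * s \<le> \<delta> / 4 * A / (D * (4 * growth_const))"
    using C(1) by simp
  then have tD: "D * t * (4 * growth_const) \<le> \<delta> / 4"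
    using A D growth_const_pos by (simp add: t_def field_simps)
  obtain N where N: "\<And>w. \<bar>f w - f (truncate N w)\<bar> \<le> s\<^sup>2"
    using uniform_truncate[OF f, of "s\<^sup>2"] s by auto
  define h where "h w = f w - f (truncate N w)" for w
  have cP: "continuous_on UNIV (\<lambda>w. f (truncate N w))"
    by (rule continuous_on_compose2[OF f continuous_truncate]) auto
  have bf: "walsh2.bounded_measurable f"
    by (rule bounded_measurable_continuous[OF f B])
  have bP: "walsh2.bounded_measurable (\<lambda>w. f (truncate N w))"
    by (rule bounded_measurable_continuous[OF cP B])
  have hs: "\<bar>h w\<bar> \<le> s\<^sup>2" for w
    using N by (simp add: h_def)
  have bh: "walsh2.bounded_measurable h"
    using hs unfolding h_def[abs_def]
    by (intro bounded_measurable_continuous continuous_on_diff f cP) (auto simp: h_def)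
  define M where "M = (2::nat) ^ N"
  define Q where "Q = exp (\<phi> ((real M)\<^sup>2 * B + B))"
  define y where "y l p = A * (sqrt \<bar>kaczmarz_sum l l h p\<bar> / s)" for l p
  have B0: "0 \<le> B"
    using B[of undefined] by linarith
  have large: "exp (\<phi> \<bar>kaczmarz_sum l l f p - f p\<bar>) - 1 \<le> D * t * exp (y l p) + \<delta> / 4" if "M \<le> l" for l p
  proof -
    have "kaczmarz_sum l l f p = kaczmarz_sum l l h p + f (truncate N p)"
      using kaczmarz_sum_add[OF bh bP, of l l p] kaczmarz_sum_truncate[OF bP, of l p] that
      by (simp add: h_def M_def)
    then have "\<bar>kaczmarz_sum l l f p - f p\<bar> \<le> \<bar>kaczmarz_sum l l h p\<bar> + s\<^sup>2"
      using hs[of p] by (simp add: h_def)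
    then have "sqrt \<bar>kaczmarz_sum l l f p - f p\<bar> \<le> sqrt (\<bar>kaczmarz_sum l l h p\<bar> + s\<^sup>2)"
      by simp
    also have "\<dots> \<le> sqrt \<bar>kaczmarz_sum l l h p\<bar> + s"
      using sqrt_add_le_add_sqrt[of "\<bar>kaczmarz_sum l l h p\<bar>" "s\<^sup>2"] s by simp
    finally have "\<phi> \<bar>kaczmarz_sum l l f p - f p\<bar> \<le> \<eta> + C * (sqrt \<bar>kaczmarz_sum l l h p\<bar> + s)"
      using C(2)[of "\<bar>kaczmarz_sum l l f p - f p\<bar>"] C(1)
      by (smt (verit) abs_ge_zero mult_left_mono)
    also have "\<dots> \<le> ln D + t * y l p"
      using s1 A s by (simp add: \<eta>_def t_def y_def algebra_simps)
    finally have "exp (\<phi> \<bar>kaczmarz_sum l l f p - f p\<bar>) \<le> D * exp (t * y l p)"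
      using D by (metis exp_add exp_le_cancel_iff exp_ln less_trans zero_less_one)
    also have "\<dots> \<le> D * (1 + t * exp (y l p))"
      using exp_scale_le[OF t, of "y l p"] D by (intro mult_left_mono) auto
    finally show ?thesis
      by (simp add: D_def algebra_simps)
  qed
  have small: "exp (\<phi> \<bar>kaczmarz_sum l l f p - f p\<bar>) - 1 \<le> Q" if "l < M" for l p
  proof -
    have "\<bar>kaczmarz_sum l l f p\<bar> \<le> (real l)\<^sup>2 * B"
      by (rule abs_kaczmarz_sum_le[OF bf B])
    also have "\<dots> \<le> (real M)\<^sup>2 * B"
      using that B0 by (intro mult_right_mono power_mono) auto
    finally have "\<bar>kaczmarz_sum l l f p - f p\<bar> \<le> (real M)\<^sup>2 * B + B"
      using B[of p] by linarith
    then have "exp (\<phi> \<bar>kaczmarz_sum l l f p - f p\<bar>) \<le> Q"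
      unfolding Q_def exp_le_cancel_iff by (rule mono[OF abs_ge_zero])
    then show ?thesis by simp
  qed
  have Q: "0 < Q"
    by (simp add: Q_def)
  have bound: "(\<Sum>l=1..n. (exp (\<phi> \<bar>kaczmarz_sum l l f p - f p\<bar>) - 1)) \<le> real M * Q + \<delta> / 2 * n" for n p
  proof -
    have pos: "0 \<le> D * t * exp (y l p) + \<delta> / 4" for l
      using D t \<delta> by simp
    have "exp (\<phi> \<bar>kaczmarz_sum l l f p - f p\<bar>) - 1
        \<le> of_bool (l < M) * Q + (D * t * exp (y l p) + \<delta> / 4)" for l
      using small[of l p] large[of l p] pos[of l] by (cases "l < M") auto
    then have "(\<Sum>l=1..n. (exp (\<phi> \<bar>kaczmarz_sum l l f p - f p\<bar>) - 1))
        \<le> (\<Sum>l=1..n. of_bool (l < M) * Q + (D * t * exp (y l p) + \<delta> / 4))"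
      by (intro sum_mono)
    also have "\<dots> = (\<Sum>l=1..n. of_bool (l < M)) * Q + D * t * (\<Sum>l=1..n. exp (y l p)) + n * (\<delta> / 4)"
      by (simp add: sum.distrib sum_distrib_left sum_distrib_right)
    also have "(\<Sum>l=1..n. of_bool (l < M) :: real) \<le> real M"
    proof -
      have "(\<Sum>l=1..n. of_bool (l < M) :: real) = real (card ({1..n} \<inter> {l. l < M}))"
        by (simp add: of_bool_def sum.If_cases)
      also have "card ({1..n} \<inter> {l. l < M}) \<le> card {..<M}"
        by (intro card_mono) auto
      finally show ?thesis by simp
    qed
    also have "(\<Sum>l=1..n. exp (y l p)) \<le> 4 * growth_const * n"
      unfolding y_def A_def by (rule sum_growth_kaczmarz_scaled[OF bh hs s])
    also have "real M * Q + D * t * (4 * growth_const * n) + n * (\<delta> / 4)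
        = real M * Q + (D * t * (4 * growth_const)) * n + n * (\<delta> / 4)"
      by simp
    also have "\<dots> \<le> real M * Q + (\<delta> / 4) * n + n * (\<delta> / 4)"
      using tD by (intro add_mono mult_right_mono order_refl) auto
    finally show ?thesis
      using Q D t by (simp add: mult_left_mono mult_right_mono)
  qed
  \<comment> \<open>From here on the total \<open>M * Q\<close> of the small orders is at most
    \<delta>/4 times n; \<open>Suc\<close> keeps n positive.\<close>
  define n0 where "n0 = Suc (nat \<lceil>real M * Q / (\<delta> / 4)\<rceil>)"
  show "\<exists>n0. \<forall>n\<ge>n0. norm (sup_norm (\<lambda>p. 1 / real n *
          (\<Sum>l=1..n. (exp (\<phi> \<bar>kaczmarz_sum l l f p - f p\<bar>) - 1))) - 0) < \<delta>"
  proof (intro exI[of _ n0] allI impI)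
    fix n
    assume n: "n0 \<le> n"
    then have n1: "0 < real n"
      by (simp add: n0_def)
    have "real M * Q / (\<delta> / 4) \<le> real n"
      using n unfolding n0_def by linarith
    then have MQ: "real M * Q \<le> \<delta> / 4 * real n"
      using \<delta> by (simp add: field_simps)
    have le: "\<bar>1 / real n * (\<Sum>l=1..n. (exp (\<phi> \<bar>kaczmarz_sum l l f p - f p\<bar>) - 1))\<bar> \<le> 3 / 4 * \<delta>" for p
    proof -
      have "0 \<le> (\<Sum>l=1..n. (exp (\<phi> \<bar>kaczmarz_sum l l f p - f p\<bar>) - 1))"
        by (intro sum_nonneg) (simp add: nn)
      moreover have "(\<Sum>l=1..n. (exp (\<phi> \<bar>kaczmarz_sum l l f p - f p\<bar>) - 1)) \<le> 3 / 4 * \<delta> * n"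
        using bound[where n=n and p=p] MQ by (simp add: algebra_simps)
      ultimately show ?thesis
        using n1 by (simp add: divide_le_eq)
    qed
    show "norm (sup_norm (\<lambda>p. 1 / real n *
          (\<Sum>l=1..n. (exp (\<phi> \<bar>kaczmarz_sum l l f p - f p\<bar>) - 1))) - 0) < \<delta>"
      using sup_norm_le[of "\<lambda>p. 1 / real n * (\<Sum>l=1..n. (exp (\<phi> \<bar>kaczmarz_sum l l f p - f p\<bar>) - 1))", OF le] \<delta>
      by simp
  qed
qed

section \<open>Lebesgue constants and divergence\<close>

context sign_family
begin

text \<open>The kernel is A + r D, where A is 0 or 2^q, \<bar>D\<bar> \<le> m, and the sign r can be
  reversed without changing A and D. Averaging over r gives the maximum of A and \<bar>D\<bar>,
  which is at least \<bar>D\<bar> + (1 - m / 2^q) A, and A has mean 1.\<close>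

lemma lebesgue_step:
  assumes \<alpha>: "inj \<alpha>" and m: "m \<le> 2 ^ q"
  shows "(\<integral>w. \<bar>dirichlet (\<lambda>j. e (\<alpha> j) w) m\<bar> \<partial>M) + 1 - real m / 2 ^ q
           \<le> (\<integral>w. \<bar>dirichlet (\<lambda>j. e (\<alpha> j) w) (2 ^ q + m)\<bar> \<partial>M)"
proof -
  note bmi = bounded_measurable_intros bounded_measurable_e
  define A where "A w = (\<Prod>i\<in>\<alpha> ` {..<q}. 1 + e i w)" for w
  define D where "D w = dirichlet (\<lambda>j. e (\<alpha> j) w) m" for w
  define r where "r w = e (\<alpha> q) w" for w
  define c where "c = 1 - real m / 2 ^ q"
  have c: "0 \<le> c"
    using m by (simp add: c_def)
  have bm: "bounded_measurable A" "bounded_measurable D" "bounded_measurable r"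
    unfolding A_def[abs_def] D_def[abs_def] r_def[abs_def] by (intro bmi)+
  have A1: "(\<integral>w. A w \<partial>M) = 1"
    unfolding A_def by (intro integral_prod_one_plus) simp
  obtain \<tau> where \<tau>: "is_flip (\<alpha> q) \<tau>" by (rule obtain_flip)
  have A\<tau>: "A (\<tau> w) = A w" for w
    unfolding A_def using \<alpha> by (intro prod.cong refl) (auto simp: e_flip[OF \<tau>] inj_eq)
  have D\<tau>: "D (\<tau> w) = D w" for w
    unfolding D_def dirichlet_def
  proof (intro sum.cong refl)
    fix n
    assume "n \<in> {..<m}"
    then have "n < 2 ^ q"
      using m by simp
    then have "\<not> bit n q"
      using bit_less_exp by blast
    then show "walsh_char (\<lambda>j. e (\<alpha> j) (\<tau> w)) n = walsh_char (\<lambda>j. e (\<alpha> j) w) n"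
      using \<alpha> by (intro walsh_char_cong) (auto simp: e_flip[OF \<tau>] inj_eq)
  qed
  have r\<tau>: "r (\<tau> w) = - r w" for w
    by (simp add: r_def e_flip[OF \<tau>])
  have r: "r w = 1 \<or> r w = - 1" for w
    using abs_e[of "\<alpha> q" w] by (auto simp: r_def abs_if split: if_splits)
  have Dm: "\<bar>D w\<bar> \<le> real m" for w
    unfolding D_def by (intro abs_dirichlet_le abs_e)
  have A01: "A w = 0 \<or> A w = 2 ^ q" for w
  proof (cases "\<exists>j<q. e (\<alpha> j) w = - 1")
    case True
    then have "A w = 0"
      unfolding A_def by (intro prod_zero) force+
    then show ?thesis ..
  next
    case False
    then have "1 + e i w = 2" if "i \<in> \<alpha> ` {..<q}" for i
      using that abs_e[of i w] by (auto simp: abs_if split: if_splits)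
    then have "A w = 2 ^ card (\<alpha> ` {..<q})"
      by (simp add: A_def)
    then show ?thesis
      using \<alpha> by (simp add: card_image inj_on_def inj_def)
  qed
  have pw: "2 * (\<bar>D w\<bar> + c * A w) \<le> \<bar>A w + r w * D w\<bar> + \<bar>A w - r w * D w\<bar>" for w
    using A01[of w]
  proof
    assume "A w = 2 ^ q"
    then have "c * A w = 2 ^ q - real m"
      by (simp add: c_def field_simps)
    then show ?thesis
      using Dm[of w] r[of w] \<open>A w = 2 ^ q\<close> by auto
  qed (use r[of w] in auto)
  have D_eq: "dirichlet (\<lambda>j. e (\<alpha> j) w) (2 ^ q + m) = A w + r w * D w" for w
    using \<alpha> by (simp add: dirichlet_add[OF m] dirichlet_exp A_def D_def r_def prod.reindex inj_on_def inj_def)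
  have "2 * ((\<integral>w. \<bar>D w\<bar> \<partial>M) + c * (\<integral>w. A w \<partial>M)) = (\<integral>w. 2 * (\<bar>D w\<bar> + c * A w) \<partial>M)"
    by (simp add: bounded_measurable_integrable bmi bm)
  also have "\<dots> \<le> (\<integral>w. \<bar>A w + r w * D w\<bar> + \<bar>A w + (- 1) * (r w * D w)\<bar> \<partial>M)"
    using pw by (intro integral_mono bounded_measurable_integrable bmi bm) simp
  also have "\<dots> = (\<integral>w. \<bar>A w + r w * D w\<bar> \<partial>M) + (\<integral>w. \<bar>A w + (- 1) * (r w * D w)\<bar> \<partial>M)"
    by (intro Bochner_Integration.integral_add bounded_measurable_integrable bmi bm)
  \<comment> \<open>The flip of sign q exchanges the two moduli.\<close>
  also have "(\<integral>w. \<bar>A w + (- 1) * (r w * D w)\<bar> \<partial>M) = (\<integral>w. \<bar>A w + r w * D w\<bar> \<partial>M)"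
    using integral_flip[OF \<tau>, of "\<lambda>w. \<bar>A w + r w * D w\<bar>"]
    by (simp add: A\<tau> D\<tau> r\<tau> bmi bm)
  finally show ?thesis
    by (simp add: A1 D_eq c_def D_def)
qed

text \<open>The witnesses 1, 2, 5, 10, 21, ... have alternating binary digits. Adding a leading
  digit two places higher keeps 3 l \<le> 4 * 2^q, so the loss in \<open>lebesgue_step\<close> is at
  most 1/3 and each such step gains 2/3.\<close>

lemma ex_large_lebesgue:
  assumes \<alpha>: "inj \<alpha>"
  shows "\<exists>l. 2 ^ q \<le> l \<and> 3 * l \<le> 4 * 2 ^ q \<and> real q / 3 \<le> (\<integral>w. \<bar>dirichlet (\<lambda>j. e (\<alpha> j) w) l\<bar> \<partial>M)"
proof (induction q rule: induct_nat_012)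
  case 0
  show ?case
    by (intro exI[of _ 1]) simp
next
  case 1
  have "1 \<le> (\<integral>w. \<bar>dirichlet (\<lambda>j. e (\<alpha> j) w) 2\<bar> \<partial>M)"
    using lebesgue_step[OF \<alpha>, of 1 0] by (simp add: dirichlet_def prob_space numeral_2_eq_2)
  then show ?case
    by (intro exI[of _ 2]) simp
next
  case (ge2 q)
  then obtain l where l: "2 ^ q \<le> l" "3 * l \<le> 4 * 2 ^ q"
    "real q / 3 \<le> (\<integral>w. \<bar>dirichlet (\<lambda>j. e (\<alpha> j) w) l\<bar> \<partial>M)"
    by blast
  have "real (3 * l) \<le> real (4 * 2 ^ q)"
    by (rule of_nat_mono) (rule l(2))
  then have *: "real l / 2 ^ (q + 2) \<le> 1 / 3"
    by (simp add: field_simps)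
  have "l \<le> 2 ^ (q + 2)"
    using l(2) by simp
  have arith: "(1 + (1 + w)) / 3 \<le> y" if "x + 1 - z \<le> y" "z \<le> 1 / 3" "w / 3 \<le> x" for w x y z :: real
    using that by (simp add: add_divide_distrib)
  from lebesgue_step[OF \<alpha> \<open>l \<le> 2 ^ (q + 2)\<close>] * l(3) have "real (Suc (Suc q)) / 3 \<le> (\<integral>w. \<bar>dirichlet (\<lambda>j. e (\<alpha> j) w) (2 ^ (q + 2) + l)\<bar> \<partial>M)"
    unfolding of_nat_Suc by (rule arith)
  then show ?case
    using l by (intro exI[of _ "2 ^ (q + 2) + l"]) simp
qed

end

section \<open>Extremal functions and the gliding hump\<close>

definition lebesgue_const :: "nat \<Rightarrow> real"
  where "lebesgue_const l = (\<integral>s. \<bar>kaczmarz_kernel l 0 s\<bar> \<partial>walsh_measure)"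

lemma ex_large_lebesgue_const: "\<exists>l. 2 ^ k \<le> l \<and> l \<le> 2 ^ Suc k \<and> real k / 3 \<le> lebesgue_const l"
proof -
  interpret S: sign_family walsh_measure "\<lambda>j s. rademacher j (0 + s)"
    by (rule sign_family_walsh)
  obtain l where l: "2 ^ k \<le> l" "3 * l \<le> 4 * 2 ^ k"
    "real k / 3 \<le> (\<integral>s. \<bar>dirichlet (\<lambda>j. rademacher (bit_reversal k j) (0 + s)) l\<bar> \<partial>walsh_measure)"
    using S.ex_large_lebesgue[OF inj_bit_reversal, of k k] by blast
  have "l \<le> 2 ^ Suc k"
    using l(2) by simp
  then show ?thesis
    using l kaczmarz_kernel_eq_dirichlet[OF l(1), of 0] unfolding lebesgue_const_def
    by (intro exI[of _ l]) (simp only: simp_thms)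
qed

text \<open>The kernel takes integer values, so this is the sign of the kernel; the formula makes its
  continuity evident.\<close>

definition kernel_sign :: "nat \<Rightarrow> walsh \<Rightarrow> real"
  where "kernel_sign l s = kaczmarz_kernel l 0 s / max 1 \<bar>kaczmarz_kernel l 0 s\<bar>"

text \<open>A continuous function of norm at most 1 at which the functional taking f to its (l, l)
  partial sum at the origin attains its norm, the square of the Lebesgue constant.\<close>

definition extremal :: "nat \<Rightarrow> walsh \<times> walsh \<Rightarrow> real"
  where "extremal l w = kernel_sign l (fst w) * kernel_sign l (snd w)"

lemma kaczmarz_Ints: "kaczmarz n x \<in> \<int>"
proof -
  have "rademacher k x \<in> \<int>" for k
    by (simp add: rademacher_def)
  then show ?thesis
    unfolding kaczmarz_def by (cases "n = 0") (simp_all add: Ints_mult Ints_prod Ints_power)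
qed

text \<open>A nonzero integer has modulus at least 1, so the maximum in \<open>kernel_sign\<close>
  is then the modulus itself.\<close>

lemma kernel_mult_sign: "kaczmarz_kernel l 0 s * kernel_sign l s = \<bar>kaczmarz_kernel l 0 s\<bar>"
proof (cases "kaczmarz_kernel l 0 s = 0")
  case False
  have "kaczmarz_kernel l 0 s \<in> \<int>"
    unfolding kaczmarz_kernel_def by (intro Ints_sum Ints_mult kaczmarz_Ints)
  then have "1 \<le> \<bar>kaczmarz_kernel l 0 s\<bar>"
    using False by (rule Ints_nonzero_abs_ge1)
  then show ?thesis
    by (simp add: kernel_sign_def max_def abs_if field_simps)
qed (simp add: kernel_sign_def)

lemma abs_kernel_sign_le: "\<bar>kernel_sign l s\<bar> \<le> 1"
  by (simp add: kernel_sign_def divide_le_eq_1_pos less_max_iff_disj)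

lemma abs_extremal_le: "\<bar>extremal l w\<bar> \<le> 1"
  unfolding extremal_def abs_mult by (rule mult_le_one) (simp_all add: abs_kernel_sign_le)

lemma continuous_extremal: "continuous_on UNIV (extremal l)"
proof -
  have k: "continuous_on UNIV (kernel_sign l)"
    unfolding kernel_sign_def[abs_def] kaczmarz_kernel_def
    by (intro continuous_on_divide continuous_on_max continuous_on_rabs continuous_on_sum
        continuous_on_mult continuous_on_const continuous_kaczmarz) (auto simp: max_def)
  show ?thesis
    unfolding extremal_def[abs_def]
    by (intro continuous_on_mult; rule continuous_on_compose2[OF k])
       (auto intro: continuous_on_fst continuous_on_snd continuous_on_id)
qed

lemma integral_abs_kernel:
  "(\<integral>w. \<bar>kaczmarz_kernel l 0 (fst w)\<bar> * \<bar>kaczmarz_kernel l 0 (snd w)\<bar> \<partial>walsh2_measure) = (lebesgue_const l)\<^sup>2"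
proof -
  have "integrable walsh2_measure (\<lambda>w. \<bar>kaczmarz_kernel l 0 (fst w)\<bar> * \<bar>kaczmarz_kernel l 0 (snd w)\<bar>)"
    by (intro walsh2.bounded_measurable_integrable walsh2.bounded_measurable_intros
        kaczmarz_kernel_bounded_measurable)
  from walsh2.integral_fst'[OF this] show ?thesis
    by (simp add: lebesgue_const_def power2_eq_square)
qed

lemma kaczmarz_sum_extremal: "kaczmarz_sum l l (extremal l) (0, 0) = (lebesgue_const l)\<^sup>2"
proof -
  have "kaczmarz_sum l l (extremal l) (0, 0)
      = (\<integral>w. extremal l w * kaczmarz_kernel l 0 (fst w) * kaczmarz_kernel l 0 (snd w) \<partial>walsh2_measure)"
    by (subst kaczmarz_sum_eq_integral[OF bounded_measurable_continuous[OF continuous_extremal abs_extremal_le]]) simp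
  also have "\<dots> = (\<integral>w. \<bar>kaczmarz_kernel l 0 (fst w)\<bar> * \<bar>kaczmarz_kernel l 0 (snd w)\<bar> \<partial>walsh2_measure)"
    unfolding kernel_mult_sign[symmetric] extremal_def
    by (intro Bochner_Integration.integral_cong refl) (simp only: mult_ac)
  finally show ?thesis
    by (simp only: integral_abs_kernel)
qed

lemma abs_kaczmarz_sum_le_lebesgue:
  assumes f: "walsh2.bounded_measurable f" "\<And>w. \<bar>f w\<bar> \<le> B"
  shows "\<bar>kaczmarz_sum l l f (0, 0)\<bar> \<le> B * (lebesgue_const l)\<^sup>2"
proof -
  note bmi = walsh2.bounded_measurable_intros kaczmarz_kernel_bounded_measurable f(1)
  have "\<bar>kaczmarz_sum l l f (0, 0)\<bar> =
      \<bar>\<integral>w. f w * kaczmarz_kernel l 0 (fst w) * kaczmarz_kernel l 0 (snd w) \<partial>walsh2_measure\<bar>"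
    by (subst kaczmarz_sum_eq_integral[OF f(1)]) simp
  also have "\<dots> \<le> (\<integral>w. \<bar>f w * kaczmarz_kernel l 0 (fst w) * kaczmarz_kernel l 0 (snd w)\<bar> \<partial>walsh2_measure)"
    by (rule integral_abs_bound)
  also have "\<dots> \<le> (\<integral>w. B * (\<bar>kaczmarz_kernel l 0 (fst w)\<bar> * \<bar>kaczmarz_kernel l 0 (snd w)\<bar>) \<partial>walsh2_measure)"
    using f(2) by (intro integral_mono walsh2.bounded_measurable_integrable bmi)
      (simp add: abs_mult mult.assoc mult_right_mono)
  also have "\<dots> = B * (lebesgue_const l)\<^sup>2"
    by (simp add: integral_abs_kernel)
  finally show ?thesis .
qed

text \<open>The sign of each hump agrees with that of the partial sum of the preceding humps at
  order \<open>l j\<close>, so the two contributions cannot cancel there.\<close>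

primrec hump_sum :: "(nat \<Rightarrow> nat) \<Rightarrow> nat \<Rightarrow> walsh \<times> walsh \<Rightarrow> real" where
  "hump_sum l 0 = (\<lambda>w. 0)"
| "hump_sum l (Suc j) = (\<lambda>w. hump_sum l j w +
     (if 0 \<le> kaczmarz_sum (l j) (l j) (hump_sum l j) (0, 0) then 1 else - 1) / 3 ^ j * extremal (l j) w)"

text \<open>With N the squared Lebesgue constant, the humps up to j give modulus at least N / 3^j by
  the choice of signs. The later humps have total norm at most 1 / (2 * 3^j) and take away at most
  half of this.\<close>

lemma gliding_hump:
  obtains F where "continuous_on UNIV F" "\<And>w. \<bar>F w\<bar> \<le> 3 / 2"
    "\<And>j. (lebesgue_const (l j))\<^sup>2 / (2 * 3 ^ j) \<le> \<bar>kaczmarz_sum (l j) (l j) F (0, 0)\<bar>"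
proof -
  define c :: "nat \<Rightarrow> real" where
    "c j = (if 0 \<le> kaczmarz_sum (l j) (l j) (hump_sum l j) (0, 0) then 1 else - 1) / 3 ^ j" for j
  define g where "g j w = c j * extremal (l j) w" for j w
  have hs: "hump_sum l j = (\<lambda>w. \<Sum>i<j. g i w)" for j
    by (induction j) (auto simp: g_def c_def fun_eq_iff)
  have g_le: "\<bar>g j w\<bar> \<le> (1 / 3) ^ j" for j w
    using abs_extremal_le[of "l j" w] by (simp add: g_def c_def abs_mult power_one_over divide_le_cancel)
  have sm: "summable (\<lambda>j. (1 / 3 :: real) ^ j)"
    by (intro summable_geometric) simp
  have sg: "summable (\<lambda>j. g j w)" "summable (\<lambda>j. \<bar>g j w\<bar>)" for w
    using g_le[of _ w] by (auto intro!: summable_comparison_test'[OF sm, of 0])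
  define F where "F w = (\<Sum>j. g j w)" for w
  have cg: "continuous_on UNIV (g j)" for j
    unfolding g_def[abs_def] by (intro continuous_on_mult continuous_on_const continuous_extremal)
  have chs: "continuous_on UNIV (hump_sum l j)" for j
    unfolding hs by (intro continuous_on_sum cg)
  have "uniform_limit UNIV (\<lambda>n w. \<Sum>i<n. g i w) F sequentially"
    unfolding F_def[abs_def] using g_le by (intro Weierstrass_m_test[OF _ sm]) simp
  then have cF: "continuous_on UNIV F"
    by (rule uniform_limit_theorem[rotated]) (auto intro!: always_eventually continuous_on_sum cg)
  have tail: "\<bar>F w - hump_sum l j w\<bar> \<le> 3 / 2 * (1 / 3) ^ j" for j w
  proof -
    have "F w - hump_sum l j w = (\<Sum>i. g (i + j) w)"
      unfolding F_def hs using suminf_minus_initial_segment[OF sg(1)[of w], of j] by simp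
    also have "\<bar>\<dots>\<bar> \<le> (\<Sum>i. (1 / 3) ^ j * (1 / 3) ^ i)"
      using g_le[of "_ + j" w]
      by (intro order_trans[OF summable_rabs] suminf_le summable_mult sm)
         (auto simp: summable_iff_shift[where f = "\<lambda>i. \<bar>g i w\<bar>"] sg power_add mult.commute)
    also have "\<dots> = 3 / 2 * (1 / 3) ^ j"
      by (subst suminf_mult[OF sm]) (simp add: suminf_geometric)
    finally show ?thesis .
  qed
  have F_le: "\<bar>F w\<bar> \<le> 3 / 2" for w
    using tail[of w 0] by simp
  have bF: "walsh2.bounded_measurable F"
    by (rule bounded_measurable_continuous[OF cF F_le])
  have bh: "walsh2.bounded_measurable (hump_sum l j)" for j
  proof (rule bounded_measurable_continuous[OF chs])
    have "(1 / 3 :: real) ^ j \<le> 1"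
      by (intro power_le_one) auto
    then show "\<bar>hump_sum l j w\<bar> \<le> 3" for w
      using tail[of w j] F_le[of w] by linarith
  qed
  have be: "walsh2.bounded_measurable (extremal k)" for k
    by (rule bounded_measurable_continuous[OF continuous_extremal abs_extremal_le])
  have "(lebesgue_const (l j))\<^sup>2 / (2 * 3 ^ j) \<le> \<bar>kaczmarz_sum (l j) (l j) F (0, 0)\<bar>" for j
  proof -
    let ?S = "\<lambda>f. kaczmarz_sum (l j) (l j) f (0, 0)"
    let ?N = "(lebesgue_const (l j))\<^sup>2"
    note bmi = walsh2.bounded_measurable_intros
    have "hump_sum l (Suc j) = (\<lambda>w. hump_sum l j w + c j * extremal (l j) w)"
      by (simp only: hump_sum.simps c_def)
    then have "?S (hump_sum l (Suc j)) = ?S (hump_sum l j) + c j * ?N"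
      by (simp only: kaczmarz_sum_add[OF bh walsh2.bounded_measurable_mult[OF walsh2.bounded_measurable_const be]]
          kaczmarz_sum_cmult kaczmarz_sum_extremal)
    then have 1: "?N / 3 ^ j \<le> \<bar>?S (hump_sum l (Suc j))\<bar>"
      by (auto simp: c_def)
    define R where "R w = F w + (- 1) * hump_sum l (Suc j) w" for w
    have bR: "walsh2.bounded_measurable R"
      unfolding R_def[abs_def] by (intro bmi bF bh)
    have "\<bar>R w\<bar> \<le> 1 / (2 * 3 ^ j)" for w
      using tail[of w "Suc j"] by (simp add: R_def power_one_over del: hump_sum.simps)
    then have 2: "\<bar>?S R\<bar> \<le> ?N / (2 * 3 ^ j)"
      using abs_kaczmarz_sum_le_lebesgue[OF bR, of "1 / (2 * 3 ^ j)" "l j"] by simp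
    have "?S F = ?S (hump_sum l (Suc j)) + ?S R"
      using kaczmarz_sum_add[OF bh[of "Suc j"] bR, of "l j" "l j" "(0, 0)"] by (simp add: R_def)
    moreover have "?N / 3 ^ j = ?N / (2 * 3 ^ j) + ?N / (2 * 3 ^ j)"
      by (simp add: field_simps)
    ultimately show ?thesis
      using 1 2 by linarith
  qed
  with cF F_le show thesis
    by (rule that)
qed

text \<open>Where \<phi> is large compared with the root, the partial sum of order
  \<open>l j\<close> of a gliding hump is large enough for a single term to be about 4^k, while the
  average divides only by about 2^k.\<close>

lemma exponential_divergence:
  assumes \<phi>: "\<phi> \<in> Psi" and lim: "Limsup at_top (\<lambda>u. ereal (\<phi> u / sqrt u)) = \<infinity>"
  shows "\<exists>F :: walsh \<times> walsh \<Rightarrow> real. continuous_on UNIV F \<and>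
           limsup (\<lambda>m. ereal (1 / real m *
             (\<Sum>l=1..m. (exp (\<phi> \<bar>kaczmarz_sum l l F (0, 0) - F (0, 0)\<bar>) - 1)))) = \<infinity>"
proof -
  have nn: "0 \<le> \<phi> u" if "0 \<le> u" for u
    using \<phi> that by (auto simp: Psi_def)
  have mono: "\<phi> u \<le> \<phi> v" if "0 \<le> u" "u \<le> v" for u v
    using \<phi> that by (auto simp: Psi_def mono_on_def)
  \<comment> \<open>The bound u \<ge> 2 ensures 2 u - 3/2 \<ge> u, which absorbs the value of F at
    the origin.\<close>
  have "\<exists>u\<ge>2. R \<le> \<phi> u / sqrt u" for R
  proof (rule ccontr)
    assume "\<not> ?thesis"
    then have "ereal (\<phi> u / sqrt u) \<le> ereal R" if "2 \<le> u" for u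
      using that by force
    then have "eventually (\<lambda>u. ereal (\<phi> u / sqrt u) \<le> ereal R) at_top"
      by (rule eventually_at_top_linorderI)
    then have "Limsup at_top (\<lambda>u. ereal (\<phi> u / sqrt u)) \<le> ereal R"
      by (rule Limsup_bounded)
    then show False
      using lim by simp
  qed
  then have "\<exists>u. \<forall>j. 2 \<le> u j \<and> 14 * 2 ^ j \<le> \<phi> (u j) / sqrt (u j)"
    by (intro choice allI) blast
  then obtain u :: "nat \<Rightarrow> real" where u: "\<And>j. 2 \<le> u j" "\<And>j. 14 * 2 ^ j \<le> \<phi> (u j) / sqrt (u j)"
    by blast
  \<comment> \<open>The factor 6 makes k/3 at least 2 * 2^j times the root of u, so half its square
    exceeds 2 u even after division by 3^j. Rounding up is covered by 7, and 14 = 2 * 7 yields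
    \<phi> u \<ge> 2 k.\<close>
  define k where "k j = nat \<lceil>6 * 2 ^ j * sqrt (u j)\<rceil>" for j
  have one: "1 \<le> 2 ^ j * sqrt (u j)" for j
    using mult_mono[of 1 "2 ^ j" 1 "sqrt (u j)"] u(1)[of j] by simp
  have k_ge: "6 * 2 ^ j * sqrt (u j) \<le> real (k j)" for j
    by (simp add: k_def) linarith
  have k_le: "real (k j) \<le> 7 * 2 ^ j * sqrt (u j)" for j
    using one[of j] unfolding k_def by linarith
  have k_j: "j \<le> k j" for j
  proof -
    have "real j \<le> 2 ^ j * 1"
      using of_nat_less_two_power[of j, where 'a = real] by simp
    also have "\<dots> \<le> 2 ^ j * sqrt (u j)"
      using u(1)[of j] by (intro mult_left_mono) auto
    also have "\<dots> \<le> real (k j)"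
      using k_ge[of j] one[of j] by linarith
    finally show ?thesis by simp
  qed
  have "\<exists>l. \<forall>j. 2 ^ k j \<le> l j \<and> l j \<le> 2 ^ Suc (k j) \<and> real (k j) / 3 \<le> lebesgue_const (l j)"
    by (intro choice allI ex_large_lebesgue_const)
  then obtain l where l: "\<And>j. 2 ^ k j \<le> l j" "\<And>j. l j \<le> 2 ^ Suc (k j)"
    "\<And>j. real (k j) / 3 \<le> lebesgue_const (l j)"
    by blast
  obtain F where F: "continuous_on UNIV F" "\<And>w. \<bar>F w\<bar> \<le> 3 / 2"
    "\<And>j. (lebesgue_const (l j))\<^sup>2 / (2 * 3 ^ j) \<le> \<bar>kaczmarz_sum (l j) (l j) F (0, 0)\<bar>"
    using gliding_hump[of l] by blast
  define a where "a m = exp (\<phi> \<bar>kaczmarz_sum m m F (0, 0) - F (0, 0)\<bar>) - 1" for m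
  have a0: "0 \<le> a m" for m
    by (simp add: a_def nn)
  have a_ge: "4 ^ k j - 1 \<le> a (l j)" for j
  proof -
    have "4 * 4 ^ j * u j = (6 * 2 ^ j * sqrt (u j) / 3)\<^sup>2"
    proof -
      have "(4::real) ^ j = (2 ^ j)\<^sup>2"
        by (simp add: power2_eq_square flip: power_mult_distrib)
      then show ?thesis
        using u(1)[of j] by (simp add: power_mult_distrib power_divide)
    qed
    also have "\<dots> \<le> (lebesgue_const (l j))\<^sup>2"
      using k_ge[of j] l(3)[of j] one[of j] by (intro power_mono) linarith+
    finally have "4 * 4 ^ j * u j \<le> (lebesgue_const (l j))\<^sup>2" .
    \<comment> \<open>The surplus 4^j built into \<open>k j\<close> pays for the hump's weight
      3^(-j).\<close>
    moreover have "4 * 3 ^ j * u j \<le> 4 * 4 ^ j * u j"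
      using u(1)[of j] by (intro mult_right_mono mult_left_mono power_mono) auto
    ultimately have "2 * u j \<le> (lebesgue_const (l j))\<^sup>2 / (2 * 3 ^ j)"
      by (simp add: field_simps)
    then have "u j \<le> \<bar>kaczmarz_sum (l j) (l j) F (0, 0) - F (0, 0)\<bar>"
      using F(3)[of j] F(2)[of "(0, 0)"] u(1)[of j] by linarith
    then have "\<phi> (u j) \<le> \<phi> \<bar>kaczmarz_sum (l j) (l j) F (0, 0) - F (0, 0)\<bar>"
      using u(1)[of j] by (intro mono) auto
    moreover have "2 * real (k j) \<le> \<phi> (u j)"
    proof -
      have "14 * 2 ^ j * sqrt (u j) \<le> \<phi> (u j)"
        using u[of j] by (simp add: pos_le_divide_eq)
      then show ?thesis
        using k_le[of j] by linarith
    qed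
    ultimately have "exp (2 * real (k j)) \<le> exp (\<phi> \<bar>kaczmarz_sum (l j) (l j) F (0, 0) - F (0, 0)\<bar>)"
      by simp
    moreover have "4 ^ k j \<le> exp (2 * real (k j))"
    proof -
      have "(2::real) ^ 2 \<le> exp 1 ^ 2"
        using exp_ge_add_one_self[of 1] by (intro power_mono) auto
      then have "(4::real) \<le> exp 2"
        by (simp flip: exp_of_nat_mult)
      then have "(4::real) ^ k j \<le> exp 2 ^ k j"
        by (intro power_mono) auto
      then show ?thesis
        by (simp add: mult.commute flip: exp_of_nat_mult)
    qed
    ultimately have "4 ^ k j \<le> exp (\<phi> \<bar>kaczmarz_sum (l j) (l j) F (0, 0) - F (0, 0)\<bar>)"
      by (rule order_trans[rotated])
    then show ?thesis
      by (simp add: a_def)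
  qed
  \<comment> \<open>Only the last term of the mean is kept: (4^k - 1) / (2 * 2^k) is at least j/2
    because j + 1 \<le> 2^k.\<close>
  have avg: "real j / 2 \<le> 1 / real (l j) * (\<Sum>i=1..l j. a i)" for j
  proof -
    have l1: "1 \<le> l j"
      by (rule order_trans[OF _ l(1)]) simp
    have "real (l j) \<le> real (2 ^ Suc (k j))"
      by (rule of_nat_mono) (rule l(2))
    then have l2: "real (l j) \<le> 2 * 2 ^ k j"
      by simp
    have "real j + 1 \<le> 2 ^ k j"
    proof -
      have "Suc j \<le> 2 ^ k j"
        using k_j[of j] less_exp[of "k j"] by linarith
      then have "real (Suc j) \<le> real (2 ^ k j)"
        by (rule of_nat_mono)
      then show ?thesis by simp
    qed
    then have "2 ^ k j * (real j + 1) \<le> 2 ^ k j * (2 ^ k j :: real)"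
      by (intro mult_left_mono) auto
    then have "2 ^ k j * real j + 2 ^ k j \<le> (4::real) ^ k j"
      by (simp add: distrib_left flip: power_mult_distrib)
    moreover have "(1::real) \<le> 2 ^ k j"
      by simp
    moreover have "real j / 2 * real (l j) \<le> 2 ^ k j * real j"
      using mult_left_mono[OF l2, of "real j / 2"] by (simp add: mult.commute)
    ultimately have "real j / 2 * real (l j) \<le> a (l j)"
      using a_ge[of j] by linarith
    also have "\<dots> \<le> (\<Sum>i=1..l j. a i)"
      using l1 a0 by (intro member_le_sum) auto
    finally show ?thesis
      using l1 by (simp add: field_simps)
  qed
  have "limsup (\<lambda>m. ereal (1 / real m * (\<Sum>i=1..m. a i))) = \<infinity>"
  proof (rule ccontr)
    assume "\<not> ?thesis"
    then have "limsup (\<lambda>m. ereal (1 / real m * (\<Sum>i=1..m. a i))) < \<infinity>"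
      by simp
    then obtain c where "limsup (\<lambda>m. ereal (1 / real m * (\<Sum>i=1..m. a i))) < ereal c"
      using ereal_dense2 by blast
    then have "eventually (\<lambda>m. ereal (1 / real m * (\<Sum>i=1..m. a i)) < ereal c) sequentially"
      by (rule Limsup_lessD)
    then obtain N where N: "\<And>m. N \<le> m \<Longrightarrow> 1 / real m * (\<Sum>i=1..m. a i) < c"
      by (auto simp: eventually_sequentially)
    \<comment> \<open>Since \<open>l j\<close> \<ge> 2^k > k \<ge> j, the order \<open>l j\<close>
      lies beyond N, and the mean there is at least j/2 \<ge> c.\<close>
    define j where "j = max N (nat \<lceil>2 * c\<rceil>)"
    have "N \<le> j"
      by (simp add: j_def)
    then have "N \<le> l j"
      using l(1)[of j] k_j[of j] less_exp[of "k j"] by linarith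
    then have "1 / real (l j) * (\<Sum>i=1..l j. a i) < c"
      by (rule N)
    moreover have "2 * c \<le> real j"
      using real_nat_ceiling_ge[of "2 * c"] by (rule order_trans) (simp add: j_def)
    ultimately show False
      using avg[of j] by linarith
  qed
  with F(1) show ?thesis
    unfolding a_def by (intro exI[of _ F] conjI)
qed

theorem theorem2:
  shows "(\<forall>\<phi>\<in>Psi. Limsup at_top (\<lambda>u. ereal (\<phi> u / sqrt u)) < \<infinity> \<longrightarrow>
            (\<forall>f :: walsh \<times> walsh \<Rightarrow> real. continuous_on UNIV f \<longrightarrow>
              (\<lambda>n. sup_norm (\<lambda>p. 1 / real n *
                  (\<Sum>l=1..n. (exp (\<phi> \<bar>kaczmarz_sum l l f p - f p\<bar>) - 1)))) \<longlonglongrightarrow> 0))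
       \<and> (\<forall>\<phi>\<in>Psi. Limsup at_top (\<lambda>u. ereal (\<phi> u / sqrt u)) = \<infinity> \<longrightarrow>
            (\<exists>F :: walsh \<times> walsh \<Rightarrow> real. continuous_on UNIV F \<and>
              limsup (\<lambda>m. ereal (1 / real m *
                  (\<Sum>l=1..m. (exp (\<phi> \<bar>kaczmarz_sum l l F (0, 0) - F (0, 0)\<bar>) - 1)))) = \<infinity>))"
  by (intro conjI ballI impI allI exponential_summability exponential_divergence)

end
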